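(* 1. Let $\psi$ be a generic function from the Stieltjes class $\mathbf{S}$, and let $$E_{\psi}(z)=\sum_{k=0}^{\infty}\frac{\psi(k+1)}{k!}z^{k}.$$ Then $E_{\psi}$ is a Hurwitz stable entire function. 2. Let $\psi$ be a generic function from the Stieltjes class $\mathbf{S}^{-1}$, and let $$E_{\psi}^{-}(z)=\sum_{k=0}^{\infty}\frac{\psi(k)}{k!}z^{k}.$$ (a) If $\psi(0)\neq 0$, then $E_{\psi}^{-}$ is a Hurwitz stable entire function. (b) If $\psi(0)=0$, then $E_{\psi}^{-}$ has a simple root at $z=0$, and the function $z^{-1}E_{\psi}^{-}(z)$ is a Hurwitz stable entire function.
   Context: Hurwitz stability: an entire function $\Phi$ is called Hurwitz stable if it grows not more than exponentially, i.e. $\limsup_{z\to\infty}|z|^{-1}\ln|\Phi(z)|<\infty$, and (1) all roots of $\Phi$ lie in the open left half-plane $\{z:\operatorname{Re}z<0\}$; (2) $h_{\Phi}(0)\ge h_{\Phi}(\pi)$, where $h_{\Phi}(\theta)=\limsup_{r\to\infty}r^{-1}\ln|\Phi(re^{i\theta})|$ is the indicator function of $\Phi$. Stieltjes classes: let $\psi$ be holomorphic in $\mathbb{C}\setminus(-\infty,0]$. Then $\psi\in\mathbf{S}$ if $\psi(x)>0$ for $0<x<\infty$ and $\operatorname{Im}\psi(z)\le 0$ whenever $\operatorname{Im}z\ge 0$; and $\psi\in\mathbf{S}^{-1}$ if $\psi(x)>0$ for $0<x<\infty$ and $\operatorname{Im}\psi(z)\ge 0$ whenever $\operatorname{Im}z\ge0$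 (with $z$ in the domain of $\psi$). Functions from these classes are assumed to be non-constant. For $\psi\in\mathbf{S}^{-1}$, the value $\psi(0)$ is defined as $\lim_{t\to+0}\psi(t)$, which exists and satisfies $0\le\psi(0)<\infty$. Special and generic functions: $\psi\in\mathbf{S}$ is special if $\psi(z)=a+\frac{b}{z}$ with constants $a\ge0$, $b>0$; $\psi\in\mathbf{S}^{-1}$ is special if $\psi(z)=a+bz$ with constants $a\ge0$, $b>0$. A function of $\mathbf{S}$ or $\mathbf{S}^{-1}$ that is not special is called generic. Both Taylor series converge for all $z\in\mathbb{C}$, so $E_\psi$ and $E_\psi^-$ are entire functions. *)

theory Defs
  imports "HOL-Complex_Analysis.Complex_Analysis"
begin

text \<open>
  Extended real logarithm of the modulus, with value \<open>-\<infinity>\<close> at zeros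
  (the library function \<^const>\<open>ln\<close> would give \<open>0\<close> there).
\<close>

definition ln_norm :: "complex \<Rightarrow> ereal" where
  "ln_norm w = (if w = 0 then - \<infinity> else ereal (ln (norm w)))"

definition exponential_growth :: "(complex \<Rightarrow> complex) \<Rightarrow> bool" where
  "exponential_growth \<Phi> \<longleftrightarrow>
     Limsup at_infinity (\<lambda>z. ereal (inverse (norm z)) * ln_norm (\<Phi> z)) < \<infinity>"

definition indicator_function :: "(complex \<Rightarrow> complex) \<Rightarrow> real \<Rightarrow> ereal" where
  "indicator_function \<Phi> \<theta> =
     Limsup at_top (\<lambda>r::real. ereal (inverse r) * ln_norm (\<Phi> (complex_of_real r * cis \<theta>)))"

definition hurwitz_stable :: "(complex \<Rightarrow> complex) \<Rightarrow> bool" where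
  "hurwitz_stable \<Phi> \<longleftrightarrow>
     \<Phi> holomorphic_on UNIV \<and>
     exponential_growth \<Phi> \<and>
     (\<forall>z. \<Phi> z = 0 \<longrightarrow> Re z < 0) \<and>
     indicator_function \<Phi> 0 \<ge> indicator_function \<Phi> pi"

text \<open>
  Elements of the two Stieltjes classes are functions on the slit plane
  \<open>- \<real>\<^sub>\<le>\<^sub>0\<close>; as HOL functions are total, their values on the cut
  are irrelevant, and all conditions below are restricted to the slit plane.
\<close>

definition stieltjes_S :: "(complex \<Rightarrow> complex) set" where
  "stieltjes_S = {\<psi>. \<psi> holomorphic_on (- \<real>\<^sub>\<le>\<^sub>0) \<and>
     \<not> \<psi> constant_on (- \<real>\<^sub>\<le>\<^sub>0) \<and>
     (\<forall>x::real. 0 < x \<longrightarrow> \<psi> (of_real x) \<in> \<real> \<and> 0 < Re (\<psi> (of_real x))) \<and>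
     (\<forall>z. z \<notin> \<real>\<^sub>\<le>\<^sub>0 \<and> 0 \<le> Im z \<longrightarrow> Im (\<psi> z) \<le> 0)}"

definition stieltjes_S_inv :: "(complex \<Rightarrow> complex) set" where
  "stieltjes_S_inv = {\<psi>. \<psi> holomorphic_on (- \<real>\<^sub>\<le>\<^sub>0) \<and>
     \<not> \<psi> constant_on (- \<real>\<^sub>\<le>\<^sub>0) \<and>
     (\<forall>x::real. 0 < x \<longrightarrow> \<psi> (of_real x) \<in> \<real> \<and> 0 < Re (\<psi> (of_real x))) \<and>
     (\<forall>z. z \<notin> \<real>\<^sub>\<le>\<^sub>0 \<and> 0 \<le> Im z \<longrightarrow> 0 \<le> Im (\<psi> z))}"

definition special_S :: "(complex \<Rightarrow> complex) \<Rightarrow> bool" where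
  "special_S \<psi> \<longleftrightarrow> (\<exists>a b::real. 0 \<le> a \<and> 0 < b \<and>
     (\<forall>z. z \<notin> \<real>\<^sub>\<le>\<^sub>0 \<longrightarrow> \<psi> z = of_real a + of_real b / z))"

definition special_S_inv :: "(complex \<Rightarrow> complex) \<Rightarrow> bool" where
  "special_S_inv \<psi> \<longleftrightarrow> (\<exists>a b::real. 0 \<le> a \<and> 0 < b \<and>
     (\<forall>z. z \<notin> \<real>\<^sub>\<le>\<^sub>0 \<longrightarrow> \<psi> z = of_real a + of_real b * z))"

definition generic_S :: "(complex \<Rightarrow> complex) \<Rightarrow> bool" where
  "generic_S \<psi> \<longleftrightarrow> \<psi> \<in> stieltjes_S \<and> \<not> special_S \<psi>"

definition generic_S_inv :: "(complex \<Rightarrow> complex) \<Rightarrow> bool" where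
  "generic_S_inv \<psi> \<longleftrightarrow> \<psi> \<in> stieltjes_S_inv \<and> \<not> special_S_inv \<psi>"

text \<open>
  The point \<open>0\<close> lies on the cut: the value \<open>\<psi>(0)\<close> means the limit along the
  positive half-axis, not the value of the total function at \<open>0\<close>.
\<close>

definition value_at_0 :: "(complex \<Rightarrow> complex) \<Rightarrow> complex" where
  "value_at_0 \<psi> = Lim (at_right 0) (\<lambda>t::real. \<psi> (of_real t))"

definition E_fun :: "(complex \<Rightarrow> complex) \<Rightarrow> complex \<Rightarrow> complex" where
  "E_fun \<psi> z = (\<Sum>k. \<psi> (of_nat (k + 1)) / fact k * z ^ k)"

definition E_minus :: "(complex \<Rightarrow> complex) \<Rightarrow> complex \<Rightarrow> complex" where
  "E_minus \<psi> z =
     (\<Sum>k. (if k = 0 then value_at_0 \<psi> else \<psi> (of_nat k)) / fact k * z ^ k)"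

definition simple_root :: "(complex \<Rightarrow> complex) \<Rightarrow> complex \<Rightarrow> bool" where
  "simple_root f a \<longleftrightarrow> f a = 0 \<and> deriv f a \<noteq> 0"

end

theory Submission
  imports Defs "HOL-Probability.Probability"
begin

text \<open>
  Transplant \<open>\<psi> \<in> \<^bold>S\<close> to the unit disc and shrink: the Cauchy formula on the unit circle together with the
  sign of \<open>Im \<psi>\<close> gives an integral representation by a positive measure, and Helly's theorem lets
  the radius tend to \<open>1\<close>. With \<open>s = 1 / (1 + t)\<close> replacing the usual Stieltjes kernel \<open>1 / (x + t)\<close>,
  this is \<open>\<psi> x = a + \<integral> 1 / (1 + s (x - 1)) dN s\<close> on \<open>0 < s \<le> 1\<close>; the class \<open>\<^bold>S\<close>\<open>\<^sup>-\<^sup>1\<close> follows by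
  \<open>z \<mapsto> 1 / z\<close>. Hence \<open>\<psi>(k + 1)\<close> is a sum of the moments \<open>1 / (1 + s k)\<close> of the densities
  \<open>u powr t\<close>, which increase in \<open>u\<close>, and one integration by parts, as in Polya's theorem on the zeros of
  \<open>\<integral> \<phi> u exp (z u) du\<close> for increasing \<open>\<phi>\<close>, shows \<open>Re (z exp (- z) E z) \<ge> 0\<close> for \<open>Re z \<ge> 0\<close>.
  The inequality is strict for \<open>z \<noteq> 0\<close> unless \<open>N\<close> lives on \<open>{0, 1}\<close>, which is the special case. The
  condition on the indicator holds because the Taylor coefficients are nonnegative.
\<close>

section \<open>Positive kernels on the disc\<close>

text \<open>The Cauchy kernels at \<open>w\<close> and \<open>0\<close> are combined with a term
  whose pole is the reflected point \<open>1 / w\<close>; that term integrates to zero. On the unit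
  circle the combination becomes a purely imaginary factor times a real kernel, so real parts
  involve only \<open>Im f\<close> on the boundary. The second formula does the same for the
  derivative, with \<open>1 / u^2 - 1\<close>.\<close>

lemma disc_boundary_integrals:
  fixes f :: "complex \<Rightarrow> complex" and w :: real
  assumes f: "f holomorphic_on ball 0 R" and R: "1 < R" and w: "\<bar>w\<bar> < 1"
  shows "((\<lambda>t. f (cis (2*pi*t)) * (- 2 * \<i> * sin (2*pi*t)) * (w / (1 - 2*w*cos (2*pi*t) + w\<^sup>2)))
            has_integral (f w - f 0)) {0..1}" (is ?A)
    and "((\<lambda>t. f (cis (2*pi*t)) * (- 2 * \<i> * sin (2*pi*t))) has_integral deriv f 0) {0..1}" (is ?B)
proof -
  let ?e = "\<lambda>t::real. cis (2*pi*t)"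
  have cont: "continuous_on (cball 0 1) f"
    using holomorphic_on_imp_continuous_on[OF f] by (rule continuous_on_subset) (use R in auto)
  have hol: "f holomorphic_on ball 0 1"
    using f by (rule holomorphic_on_subset) (use R in auto)
  have cp: "circlepath 0 1 t = ?e t" for t
    by (simp add: circlepath cis_conv_exp mult_ac)
  have vd: "vector_derivative (circlepath 0 1) (at t) = 2*pi*\<i> * ?e t" for t
    by (simp add: vector_derivative_circlepath cis_conv_exp mult_ac)
  have conv: "(g has_contour_integral i) (circlepath 0 1) \<longleftrightarrow>
      ((\<lambda>t. g (?e t) * (2*pi*\<i> * ?e t)) has_integral i) {0..1}" for g i
    unfolding has_contour_integral cp vd ..
  have Cauchy: "((\<lambda>u. f u / (u - v)) has_contour_integral (2*pi*\<i> * f v)) (circlepath 0 1)"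
    if "norm v < 1" for v
    using Cauchy_integral_circlepath[OF cont hol, of v] that by simp
  have Cauchy2: "((\<lambda>u. f u / u^2) has_contour_integral (2*pi*\<i> * deriv f 0)) (circlepath 0 1)"
    using Cauchy_has_contour_integral_higher_derivative_circlepath[OF cont hol, of 0 1]
    by (simp add: power2_eq_square)
  \<comment> \<open>A radius slightly above \<open>1\<close>: the closed unit disc has to lie
    inside, the pole \<open>1 / w\<close> outside.\<close>
  obtain R' where R': "1 < R'" "R' \<le> R" "\<bar>w\<bar> * R' < 1"
  proof (cases "w = 0")
    case True then show ?thesis using that[of R] R by simp
  next
    case False
    then have *: "1 < 1 / \<bar>w\<bar>" using w by simp
    have "1 < min R (1/\<bar>w\<bar>)" using R * by simp
    then obtain R' where "1 < R'" "R' < min R (1/\<bar>w\<bar>)" using dense by blast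
    then show ?thesis using that[of R'] False by (simp add: field_simps)
  qed
  have nz: "1 - w * u \<noteq> 0" if "norm u < R'" for u :: complex
  proof
    assume "1 - w * u = 0"
    then have "norm (w * u) = 1" by (metis eq_iff_diff_eq_0 norm_one)
    moreover have "norm (w * u) \<le> \<bar>w\<bar> * R'" using that by (auto simp: norm_mult intro!: mult_mono)
    ultimately show False using R' by simp
  qed
  have zero: "(g has_contour_integral 0) (circlepath 0 1)" if "g holomorphic_on ball 0 R'" for g
    by (rule Cauchy_theorem_disc_simple[OF that]) (use R' in auto)
  have fR': "f holomorphic_on ball 0 R'" using f by (rule holomorphic_on_subset) (use R' in auto)
  have 2: "((\<lambda>u. f u * (w / (1 - w * u))) has_contour_integral 0) (circlepath 0 1)"
    by (intro zero holomorphic_intros fR') (use nz in auto)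
  have "((\<lambda>u. f u / (u - w) - f u / (u - 0) - f u * (w / (1 - w * u))) has_contour_integral
     (2*pi*\<i> * f w - 2*pi*\<i> * f 0 - 0)) (circlepath 0 1)"
    by (intro has_contour_integral_diff Cauchy 2) (use w in auto)
  then have "((\<lambda>t. (f (?e t) / (?e t - w) - f (?e t) / (?e t - 0) - f (?e t) * (w / (1 - w * ?e t)))
       * (2*pi*\<i> * ?e t)) has_integral (2*pi*\<i> * f w - 2*pi*\<i> * f 0 - 0)) {0..1}"
    unfolding conv .
  then have "((\<lambda>t. (f (?e t) / (?e t - w) - f (?e t) / (?e t - 0) - f (?e t) * (w / (1 - w * ?e t)))
       * (2*pi*\<i> * ?e t) / (2*pi*\<i>)) has_integral ((2*pi*\<i> * f w - 2*pi*\<i> * f 0 - 0) / (2*pi*\<i>))) {0..1}"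
    by (rule has_integral_divide)
  moreover have "(f (?e t) / (?e t - w) - f (?e t) / (?e t - 0) - f (?e t) * (w / (1 - w * ?e t)))
       * (2*pi*\<i> * ?e t) / (2*pi*\<i>) =
       f (?e t) * (- 2 * \<i> * sin (2*pi*t)) * (w / (1 - 2*w*cos (2*pi*t) + w\<^sup>2))" for t
  proof -
    define e where "e = ?e t"
    have e0: "e \<noteq> 0" and en: "norm e = 1" by (auto simp: e_def)
    have ee: "e * cnj e = 1" using en by (simp add: complex_norm_square[symmetric])
    have n1: "e - w \<noteq> 0"
      using en w by (metis eq_iff_diff_eq_0 norm_of_real less_irrefl)
    have n2: "1 - w * e \<noteq> 0" using nz[of e] en R' by simp
    have cs: "cos (2*pi*t) = (e + cnj e)/2" "sin (2*pi*t) = (e - cnj e)/(2*\<i>)"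
      by (auto simp: e_def complex_eq_iff)
    \<comment> \<open>By \<open>e * cnj e = 1\<close> the real denominator factors through both
      poles, so the two sides can be compared as rational expressions in \<open>e\<close> and
      \<open>cnj e\<close>.\<close>
    have cnjw: "1 - 2*w*cos (2*pi*t) + w\<^sup>2 = (e - w) * (1 - w * e) * cnj e"
    proof -
      have "complex_of_real (1 - 2*w*cos (2*pi*t) + w\<^sup>2) = 1 - w*(e + cnj e) + w^2"
        by (simp add: cs(1))
      also have "\<dots> = e * cnj e - w*(e*cnj e * e + cnj e) + w^2 * (e * cnj e)"
        by (simp add: ee)
      also have "\<dots> = (e - w) * (1 - w * e) * cnj e" by (simp add: algebra_simps power2_eq_square)
      finally show ?thesis .
    qed
    have c0: "cnj e \<noteq> 0" using e0 by simp
    have "(1 / (e - w) - 1 / e - w / (1 - w * e)) * e * ((e - w) * (1 - w * e) * cnj e)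
        = ((1 - w * e) * e - (e - w) * (1 - w * e) - w * e * (e - w)) * cnj e"
      using n1 n2 e0 by (simp add: divide_simps) (simp add: algebra_simps)
    also have "\<dots> = (w - w * e * e) * cnj e" by (simp add: algebra_simps)
    also have "\<dots> = w * cnj e - w * e * (e * cnj e)" by (simp add: algebra_simps)
    also have "\<dots> = (- 2 * \<i> * sin (2*pi*t)) * w" unfolding cs ee by (simp add: field_simps)
    finally have "(1 / (e - w) - 1 / e - w / (1 - w * e)) * e =
       (- 2 * \<i> * sin (2*pi*t)) * w / ((e - w) * (1 - w * e) * cnj e)"
      by (subst eq_divide_eq) (use n1 n2 c0 in simp)
    then have *: "(1 / (e - w) - 1 / e - w / (1 - w * e)) * e =
       (- 2 * \<i> * sin (2*pi*t)) * (w / ((e - w) * (1 - w * e) * cnj e))"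
      by simp
    have "(f e / (e - w) - f e / (e - 0) - f e * (w / (1 - w * e))) * (2*pi*\<i> * e) / (2*pi*\<i>)
        = f e * ((1 / (e - w) - 1 / e - w / (1 - w * e)) * e)"
      by (simp add: algebra_simps divide_simps)
    also have "\<dots> = f e * (- 2 * \<i> * sin (2*pi*t)) * (w / (1 - 2*w*cos (2*pi*t) + w\<^sup>2))"
      unfolding * of_real_divide cnjw by simp
    finally show ?thesis by (simp add: e_def)
  qed
  ultimately show ?A by (simp add: diff_divide_distrib)
  have "((\<lambda>u. f u / u^2 - f u) has_contour_integral (2*pi*\<i> * deriv f 0 - 0)) (circlepath 0 1)"
    by (intro has_contour_integral_diff Cauchy2 zero fR')
  then have "((\<lambda>t. (f (?e t) / (?e t)^2 - f (?e t)) * (2*pi*\<i> * ?e t) / (2*pi*\<i>))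
      has_integral (2*pi*\<i> * deriv f 0 - 0) / (2*pi*\<i>)) {0..1}"
    unfolding conv by (rule has_integral_divide)
  moreover have "(f (?e t) / (?e t)^2 - f (?e t)) * (2*pi*\<i> * ?e t) / (2*pi*\<i>) =
     f (?e t) * (- 2 * \<i> * sin (2*pi*t))" for t
  proof -
    define e where "e = ?e t"
    have e0: "e \<noteq> 0" and en: "norm e = 1" by (auto simp: e_def)
    have ee: "inverse e = cnj e" by (simp add: e_def cis_cnj)
    have "(f e / e^2 - f e) * (2*pi*\<i> * e) / (2*pi*\<i>) = f e * (inverse e - e)"
      using e0 by (simp add: field_simps power2_eq_square)
    also have "inverse e - e = - 2 * \<i> * sin (2*pi*t)"
      unfolding ee by (auto simp: e_def complex_eq_iff)
    finally show ?thesis by (simp add: e_def)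
  qed
  moreover have "(2*pi*\<i> * deriv f 0 - 0) / (2*pi*\<i>) = deriv f 0" by simp
  ultimately show ?B by (simp only:)
qed

lemma has_integral_continuous_lborel:
  fixes g :: "real \<Rightarrow> real"
  assumes "continuous_on {a..b} g" "(g has_integral I) {a..b}"
  shows "integrable lborel (\<lambda>t. indicator {a..b} t * g t)"
    and "(\<integral>t. indicator {a..b} t * g t \<partial>lborel) = I"
proof -
  have 1: "set_integrable lborel {a..b} g"
    using assms(1) by (rule borel_integrable_atLeastAtMost')
  show "integrable lborel (\<lambda>t. indicator {a..b} t * g t)"
    using 1 by (simp add: set_integrable_def)
  show "(\<integral>t. indicator {a..b} t * g t \<partial>lborel) = I"
    using set_borel_integral_eq_integral(2)[OF 1] integral_unique[OF assms(2)]
    by (simp add: set_lebesgue_integral_def)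
qed

text \<open>The expression is a convex combination of \<open>(1 - w)^2\<close> and
  \<open>(1 + w)^2\<close>. It is the denominator of the boundary kernel in the variable
  \<open>s = (1 - cos \<theta>) / 2\<close>.\<close>

lemma disc_kernel_pos:
  fixes w s :: real
  assumes "\<bar>w\<bar> < 1" "0 \<le> s" "s \<le> 1"
  shows "0 < (1 - w)\<^sup>2 + 4 * s * w"
proof -
  have "(1 - w)\<^sup>2 + 4 * s * w = (1 - s) * (1 - w)\<^sup>2 + s * (1 + w)\<^sup>2"
    by (simp add: power2_eq_square algebra_simps)
  moreover have "0 < (1 - s) * (1 - w)\<^sup>2 + s * (1 + w)\<^sup>2"
  proof (cases "s = 0")
    case False
    then show ?thesis using assms by (intro add_nonneg_pos) auto
  qed (use assms in auto)
  ultimately show ?thesis by simp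
qed

text \<open>The sign condition makes the boundary function \<open>- 2 * sin \<theta> * Im f\<close>
  nonnegative, and the formula for \<open>deriv f 0\<close> gives its mass
  \<open>- Re (deriv f 0)\<close>. The kernel depends on \<theta> only through
  \<open>s = (1 - cos \<theta>) / 2\<close>, so \<open>\<mu>\<close> is the normalized density
  pushed forward by \<open>s\<close>.\<close>

lemma disc_representation:
  fixes f :: "complex \<Rightarrow> complex"
  assumes f: "f holomorphic_on ball 0 R" and R: "1 < R"
    and sgn: "\<And>u. norm u = 1 \<Longrightarrow> Im u * Im (f u) \<le> 0"
  shows "Re (deriv f 0) \<le> 0"
    and "\<exists>\<mu>. real_distribution \<mu> \<and> (AE s in \<mu>. s \<in> {0..1}) \<and>
    (\<forall>w::real. \<bar>w\<bar> < 1 \<longrightarrow>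
       Re (f w) = Re (f 0) + Re (deriv f 0) * (\<integral>s. w / ((1 - w)\<^sup>2 + 4 * s * w) \<partial>\<mu>))"
proof -
  define D where "D = - Re (deriv f 0)"
  define d where "d t = - 2 * Im (f (cis (2*pi*t))) * sin (2*pi*t)" for t
  define \<sigma> where "\<sigma> t = (1 - cos (2*pi*t)) / 2" for t
  define K where "K w s = w / ((1 - w)\<^sup>2 + 4 * s * w)" for w s :: real
  have d0: "0 \<le> d t" for t
    using sgn[of "cis (2*pi*t)"] by (simp add: d_def mult_ac)
  have "continuous_on UNIV (\<lambda>t. f (cis (2*pi*t)))"
    by (rule continuous_on_compose2[OF holomorphic_on_imp_continuous_on[OF f]])
       (use R in \<open>auto intro!: continuous_intros\<close>)
  then have dcont: "continuous_on A d" for A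
    unfolding d_def by (intro continuous_intros) (auto intro: continuous_on_subset)
  have dmeas[measurable]: "d \<in> borel_measurable borel"
    by (intro borel_measurable_continuous_onI dcont)
  have \<sigma>cont: "continuous_on A \<sigma>" for A unfolding \<sigma>_def by (intro continuous_intros) auto
  have \<sigma>meas[measurable]: "\<sigma> \<in> borel_measurable borel"
    by (intro borel_measurable_continuous_onI \<sigma>cont)
  have \<sigma>01: "0 \<le> \<sigma> t" "\<sigma> t \<le> 1" for t
    using cos_ge_minus_one[of "2*pi*t"] by (auto simp: \<sigma>_def)
  have Kmeas[measurable]: "K w \<in> borel_measurable borel" for w unfolding K_def by measurable
  have hd: "(d has_integral D) {0..1}"
    using has_integral_Re[OF has_integral_neg[OF disc_boundary_integrals(2)[OF f R, of 0]]]
    by (simp add: d_def[abs_def] D_def mult_ac)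
  have hK: "((\<lambda>t. d t * K w (\<sigma> t)) has_integral Re (f 0) - Re (f w)) {0..1}" if "\<bar>w\<bar> < 1" for w :: real
  proof -
    have "1 - 2*w*cos (2*pi*t) + w\<^sup>2 = (1 - w)\<^sup>2 + 4 * \<sigma> t * w" for t
      by (simp add: \<sigma>_def power2_eq_square field_simps)
    then show ?thesis
      using has_integral_Re[OF has_integral_neg[OF disc_boundary_integrals(1)[OF f R that]]]
      by (simp add: d_def[abs_def] K_def Re_divide_of_real mult_ac)
  qed
  have Kcont: "continuous_on A (\<lambda>t. K w (\<sigma> t))" if "\<bar>w\<bar> < 1" for w A
    unfolding K_def using disc_kernel_pos[OF that \<sigma>01]
    by (intro continuous_intros \<sigma>cont) (auto simp: less_le)
  show "Re (deriv f 0) \<le> 0"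
    using has_integral_nonneg[OF hd d0] by (simp add: D_def)
  show "\<exists>\<mu>. real_distribution \<mu> \<and> (AE s in \<mu>. s \<in> {0..1}) \<and>
    (\<forall>w::real. \<bar>w\<bar> < 1 \<longrightarrow>
       Re (f w) = Re (f 0) + Re (deriv f 0) * (\<integral>s. w / ((1 - w)\<^sup>2 + 4 * s * w) \<partial>\<mu>))"
  proof (cases "D = 0")
    \<comment> \<open>A nonnegative continuous density of mass zero vanishes, so \<open>Re f\<close>
      is constant on the real diameter and any measure serves; the point mass at \<open>0\<close> is
      taken.\<close>
    case True
    have "d t = 0" if "t \<in> {0..1}" for t
      using has_integral_0_cbox_imp_0[of 0 1 d t] dcont d0 hd True that by auto
    then have z: "((\<lambda>t. d t * K w (\<sigma> t)) has_integral 0) {0..1}" for w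
      by (intro has_integral_is_0) auto
    have "Re (f w) = Re (f 0)" if "\<bar>w\<bar> < 1" for w :: real
      using has_integral_unique[OF hK[OF that] z[of w]] by simp
    moreover have "real_distribution (return borel (0::real))"
      by (intro real_distribution.intro prob_space_return real_distribution_axioms.intro) auto
    moreover have "AE s in return borel (0::real). s \<in> {0..1}" by (simp add: AE_return)
    ultimately show ?thesis using True by (auto simp: D_def)
  next
    case False
    have Dpos: "D > 0" using has_integral_nonneg[OF hd d0] False by auto
    let ?p = "\<lambda>t. indicator {0..1} t * (d t / D)"
    have p0: "0 \<le> ?p t" for t using d0 Dpos by (auto simp: indicator_def)
    have pmeas[measurable]: "?p \<in> borel_measurable lborel" by measurable
    define \<mu>0 where "\<mu>0 = density lborel (\<lambda>t. ennreal (?p t))"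
    define \<mu> where "\<mu> = distr \<mu>0 borel \<sigma>"
    have m0[measurable]: "\<sigma> \<in> borel_measurable \<mu>0" by (simp add: \<mu>0_def)
    have I: "(\<integral>s. K w s \<partial>\<mu>) = (Re (f 0) - Re (f w)) / D" if "\<bar>w\<bar> < 1" for w :: real
    proof -
      have "(\<integral>s. K w s \<partial>\<mu>) = (\<integral>t. K w (\<sigma> t) \<partial>\<mu>0)"
        unfolding \<mu>_def by (rule integral_distr) measurable
      also have "\<dots> = (\<integral>t. ?p t * K w (\<sigma> t) \<partial>lborel)"
        unfolding \<mu>0_def by (subst integral_density) (use p0 in auto)
      also have "\<dots> = (\<integral>t. (indicator {0..1} t * (d t * K w (\<sigma> t))) / D \<partial>lborel)"
        by (simp add: mult_ac)
      also have "\<dots> = (Re (f 0) - Re (f w)) / D"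
        using has_integral_continuous_lborel(2)[OF _ hK[OF that]]
        by (simp add: continuous_on_mult dcont Kcont[OF that])
      finally show ?thesis .
    qed
    have "prob_space \<mu>0"
    proof
      have "emeasure \<mu>0 (space \<mu>0) = (\<integral>\<^sup>+t. ennreal (?p t) \<partial>lborel)"
        unfolding \<mu>0_def by (subst emeasure_density) auto
      also have "\<dots> = ennreal (\<integral>t. ?p t \<partial>lborel)"
        using has_integral_continuous_lborel(1)[OF dcont hd] p0
        by (intro nn_integral_eq_integral) auto
      also have "(\<integral>t. ?p t \<partial>lborel) = 1"
        using has_integral_continuous_lborel(2)[OF dcont hd] Dpos by simp
      finally show "emeasure \<mu>0 (space \<mu>0) = 1" by simp
    qed
    then have "prob_space \<mu>" unfolding \<mu>_def by (rule prob_space.prob_space_distr) measurable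
    then have "real_distribution \<mu>"
      by (intro real_distribution.intro real_distribution_axioms.intro) (auto simp: \<mu>_def)
    moreover have "AE s in \<mu>. s \<in> {0..1}"
      unfolding \<mu>_def by (subst AE_distr_iff) (use \<sigma>01 in auto)
    moreover have "Re (f w) = Re (f 0) + Re (deriv f 0) * (\<integral>s. K w s \<partial>\<mu>)" if "\<bar>w\<bar> < 1" for w :: real
      using I[OF that] Dpos by (simp add: D_def)
    ultimately show ?thesis unfolding K_def by blast
  qed
qed

text \<open>\<open>H\<close> need not extend past the circle, so the previous representation is
  applied to \<open>u \<mapsto> H (r n * u)\<close> and \<open>r n\<close> tends to
  \<open>1\<close>. The masses \<open>- r n * Re (deriv H 0)\<close> converge explicitly, and
  compactness is needed only for the normalized measures.\<close>

lemma disc_representation_limit: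
  fixes H :: "complex \<Rightarrow> complex"
  assumes H: "H holomorphic_on ball 0 1"
    and sgn: "\<And>u. norm u < 1 \<Longrightarrow> Im u * Im (H u) \<le> 0"
  shows "Re (deriv H 0) \<le> 0"
    and "\<exists>\<mu>. real_distribution \<mu> \<and> (AE s in \<mu>. s \<in> {0..1}) \<and>
    (\<forall>w::real. \<bar>w\<bar> < 1 \<longrightarrow>
       Re (H w) = Re (H 0) + Re (deriv H 0) * (\<integral>s. w / ((1 - w)\<^sup>2 + 4 * s * w) \<partial>\<mu>))"
proof -
  define r where "r n = 1 - inverse (real (Suc (Suc n)))" for n
  have r: "0 < r n" "r n < 1" for n by (auto simp: r_def field_simps)
  have rlim: "r \<longlonglongrightarrow> 1"
  proof -
    have "(\<lambda>n. inverse (real (Suc (Suc n)))) \<longlonglongrightarrow> 0"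
      using LIMSEQ_inverse_real_of_nat by (rule LIMSEQ_Suc)
    then show ?thesis unfolding r_def using tendsto_diff[OF tendsto_const[of 1]] by fastforce
  qed
  define K where "K w s = w / ((1 - w)\<^sup>2 + 4 * s * w)" for w s :: real
  have [measurable]: "K w \<in> borel_measurable borel" for w unfolding K_def by measurable
  define f where "f n u = H (r n * u)" for n and u :: complex
  have inb: "r n * u \<in> ball 0 1" if "norm u < 1 / r n" for n and u :: complex
  proof -
    have "norm (r n * u) = r n * norm u" using r[of n] by (simp add: norm_mult)
    also have "\<dots> < 1" using that r[of n] by (simp add: field_simps)
    finally show ?thesis by simp
  qed
  have fhol: "f n holomorphic_on ball 0 (1 / r n)" for n
    unfolding f_def
    by (rule holomorphic_on_compose_gen[OF _ H, unfolded o_def]) (use inb in \<open>auto intro!: holomorphic_intros\<close>)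
  have fsgn: "Im u * Im (f n u) \<le> 0" if "norm u = 1" for n u
  proof -
    have "Im (r n * u) * Im (H (r n * u)) \<le> 0"
      using sgn[of "r n * u"] r[of n] that by (simp add: norm_mult)
    then have "r n * (Im u * Im (f n u)) \<le> 0" by (simp add: f_def mult_ac)
    then show ?thesis using r[of n] by (simp add: mult_le_0_iff)
  qed
  have fd: "deriv (f n) 0 = r n * deriv H 0" for n
    unfolding f_def
    by (subst deriv_compose_linear) (use holomorphic_on_imp_differentiable_at[OF H] in auto)
  have r1: "1 < 1 / r n" for n using r[of n] by simp
  note rep = disc_representation[OF fhol r1 fsgn]
  show "Re (deriv H 0) \<le> 0"
    using rep(1)[of 0] r[of 0] by (simp add: fd mult_le_0_iff)
  obtain \<mu> where \<mu>: "\<And>n. real_distribution (\<mu> n)" "\<And>n. AE s in \<mu> n. s \<in> {0..1}"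
    "\<And>n w. \<bar>w\<bar> < 1 \<Longrightarrow> Re (f n (of_real w)) = Re (f n 0) + Re (deriv (f n) 0) * (\<integral>s. K w s \<partial>\<mu> n)"
    using rep(2) unfolding K_def by metis
  have "tight \<mu>"
    unfolding tight_def
  proof (intro conjI allI impI)
    fix e :: real assume e: "0 < e"
    \<comment> \<open>All measures live on \<open>[0, 1]\<close>, so one half-open window containing
      it proves tightness.\<close>
    have "measure (\<mu> n) {-1<..1} = 1" for n
    proof -
      interpret real_distribution "\<mu> n" by fact
      show "prob {-1<..1} = 1"
        using \<mu>(2)[of n] by (subst prob_eq_1) (auto elim: AE_mp)
    qed
    then show "\<exists>a b. a < b \<and> (\<forall>n. 1 - e < measure (\<mu> n) {a<..b})"
      using e by (intro exI[of _ "-1"] exI[of _ "1"]) auto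
  qed (use \<mu>(1) in auto)
  then obtain s M where s: "strict_mono (s :: nat \<Rightarrow> nat)" and M: "real_distribution M"
    and conv: "weak_conv_m (\<mu> \<circ> id \<circ> s) M"
    using tight_imp_convergent_subsubsequence[of \<mu> id] strict_mono_id by blast
  \<comment> \<open>The kernel is controlled only for \<open>s\<close> in \<open>[0, 1]\<close>,
    while weak convergence tests against bounded continuous functions on the line. Clamping by
    \<open>c\<close> turns the kernel into such a function without changing its integral over
    \<open>\<mu> n\<close>, and pushing \<open>M\<close> forward by \<open>c\<close> puts the limit
    on \<open>[0, 1]\<close>.\<close>
  define c where "c s = max 0 (min 1 s)" for s :: real
  have c01: "0 \<le> c s" "c s \<le> 1" for s by (auto simp: c_def)
  have ccont: "continuous_on UNIV c" unfolding c_def by (intro continuous_intros)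
  then have cmeas[measurable]: "c \<in> borel_measurable borel" by (rule borel_measurable_continuous_onI)
  define \<nu> where "\<nu> = distr M borel c"
  interpret M: real_distribution M by fact
  have "real_distribution \<nu>" unfolding \<nu>_def by (intro M.real_distribution_distr) measurable
  moreover have "AE s in \<nu>. s \<in> {0..1}" unfolding \<nu>_def by (subst AE_distr_iff) (use c01 in auto)
  moreover have "Re (H w) = Re (H 0) + Re (deriv H 0) * (\<integral>s. K w s \<partial>\<nu>)" if w: "\<bar>w\<bar> < 1" for w :: real
  proof -
    have Kc: "continuous_on UNIV (\<lambda>t. K w (c t))"
      unfolding K_def using disc_kernel_pos[OF w c01]
      by (intro continuous_intros ccont) (auto simp: less_le)
    have "compact ((\<lambda>t. w / ((1 - w)\<^sup>2 + 4 * t * w)) ` {0..1})"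
      using disc_kernel_pos[OF w]
      by (intro compact_continuous_image continuous_intros) (auto simp: less_le)
    then obtain B where B: "\<And>t. t \<in> {0..1} \<Longrightarrow> norm (K w t) \<le> B"
      unfolding K_def by (meson bounded_iff compact_imp_bounded imageI)
    have "(\<lambda>n. \<integral>t. K w (c t) \<partial>(\<mu> \<circ> id \<circ> s) n) \<longlonglongrightarrow> (\<integral>t. K w (c t) \<partial>M)"
      by (rule weak_conv_imp_integral_bdd_continuous_conv[of "\<mu> \<circ> id \<circ> s" M _ B])
         (use conv M \<mu>(1) B c01 Kc in \<open>auto simp: continuous_on_eq_continuous_at\<close>)
    moreover have "(\<integral>t. K w (c t) \<partial>\<mu> n) = (\<integral>t. K w t \<partial>\<mu> n)" for n
    proof (rule integral_cong_AE)
      interpret real_distribution "\<mu> n" by fact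
      show "(\<lambda>t. K w (c t)) \<in> borel_measurable (\<mu> n)" "K w \<in> borel_measurable (\<mu> n)"
        by measurable
      show "AE t in \<mu> n. K w (c t) = K w t"
        using \<mu>(2)[of n] by eventually_elim (auto simp: c_def)
    qed
    moreover have "(\<integral>t. K w (c t) \<partial>M) = (\<integral>t. K w t \<partial>\<nu>)"
      unfolding \<nu>_def by (subst integral_distr) auto
    ultimately have 1: "(\<lambda>n. \<integral>t. K w t \<partial>\<mu> (s n)) \<longlonglongrightarrow> (\<integral>t. K w t \<partial>\<nu>)" by simp
    have 2: "(\<lambda>n. r (s n)) \<longlonglongrightarrow> 1" using LIMSEQ_subseq_LIMSEQ[OF rlim s] by (simp add: o_def)
    have "(\<lambda>n. Re (H 0) + (r (s n) * Re (deriv H 0)) * (\<integral>t. K w t \<partial>\<mu> (s n))) \<longlonglongrightarrow>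
        Re (H 0) + (1 * Re (deriv H 0)) * (\<integral>t. K w t \<partial>\<nu>)"
      by (intro tendsto_intros 1 2)
    moreover have "Re (H 0) + (r (s n) * Re (deriv H 0)) * (\<integral>t. K w t \<partial>\<mu> (s n)) = Re (H (r (s n) * w))" for n
      using \<mu>(3)[OF w, of "s n"] by (simp add: f_def fd)
    ultimately have 3: "(\<lambda>n. Re (H (r (s n) * w))) \<longlonglongrightarrow> Re (H 0) + Re (deriv H 0) * (\<integral>t. K w t \<partial>\<nu>)"
      by simp
    have "isCont H w"
      using continuous_on_interior[OF holomorphic_on_imp_continuous_on[OF H]] w by simp
    moreover have "(\<lambda>n. complex_of_real (r (s n)) * w) \<longlonglongrightarrow> complex_of_real 1 * complex_of_real w"
      by (intro tendsto_intros 2)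
    ultimately have "(\<lambda>n. Re (H (r (s n) * w))) \<longlonglongrightarrow> Re (H w)"
      by (intro tendsto_Re isCont_tendsto_compose[of _ H]) auto
    then show ?thesis using 3 LIMSEQ_unique by blast
  qed
  ultimately show "\<exists>\<mu>. real_distribution \<mu> \<and> (AE s in \<mu>. s \<in> {0..1}) \<and>
    (\<forall>w::real. \<bar>w\<bar> < 1 \<longrightarrow>
       Re (H w) = Re (H 0) + Re (deriv H 0) * (\<integral>s. w / ((1 - w)\<^sup>2 + 4 * s * w) \<partial>\<mu>))"
    unfolding K_def by blast
qed

section \<open>Integral representation of Stieltjes functions\<close>

text \<open>Identity theorem: the slit plane is starlike, hence connected, and the points
  \<open>1 + 1 / (n + 1)\<close> accumulate at \<open>1\<close>. Later it extends formulas from the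
  positive axis to recognize special functions.\<close>

lemma slit_plane_identity:
  assumes f: "f holomorphic_on - \<real>\<^sub>\<le>\<^sub>0" and g: "g holomorphic_on - \<real>\<^sub>\<le>\<^sub>0"
    and eq: "\<And>x::real. 0 < x \<Longrightarrow> f (of_real x) = g (of_real x)" and z: "z \<notin> \<real>\<^sub>\<le>\<^sub>0"
  shows "f z = g z"
proof -
  have slit: "- \<real>\<^sub>\<le>\<^sub>0 = - (complex_of_real ` {..0})"
    by (auto simp: nonpos_Reals_def)
  have conn: "connected (- \<real>\<^sub>\<le>\<^sub>0 :: complex set)"
    unfolding slit by (intro starlike_imp_connected starlike_slotted_complex_plane_left)
  have lim: "1 islimpt (complex_of_real ` {0<..})"
    unfolding islimpt_sequential
  proof (intro exI conjI allI)
    fix n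
    show "complex_of_real (1 + inverse (real (Suc n))) \<in> complex_of_real ` {0<..} - {1}"
      by (auto simp: image_iff complex_eq_iff intro!: add_pos_pos)
  next
    have "(\<lambda>n. complex_of_real (1 + inverse (real (Suc n)))) \<longlonglongrightarrow> of_real (1 + 0)"
      by (intro tendsto_intros LIMSEQ_inverse_real_of_nat)
    then show "(\<lambda>n. complex_of_real (1 + inverse (real (Suc n)))) \<longlonglongrightarrow> 1" by simp
  qed
  have "f z - g z = 0"
  proof (rule analytic_continuation[where f = "\<lambda>z. f z - g z", OF _ _ conn _ _ lim])
    show "(\<lambda>z. f z - g z) holomorphic_on - \<real>\<^sub>\<le>\<^sub>0" by (intro holomorphic_intros f g)
  qed (use eq z in \<open>auto simp: open_Compl\<close>)
  then show ?thesis by simp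
qed

text \<open>Schwarz reflection: \<open>cnj \<circ> \<psi> \<circ> cnj\<close> is holomorphic and
  agrees with \<psi> on the positive axis, where \<psi> is real.\<close>

lemma slit_plane_reflection:
  assumes hol: "\<psi> holomorphic_on - \<real>\<^sub>\<le>\<^sub>0"
    and re: "\<And>x::real. 0 < x \<Longrightarrow> \<psi> (of_real x) \<in> \<real>" and z: "z \<notin> \<real>\<^sub>\<le>\<^sub>0"
  shows "\<psi> (cnj z) = cnj (\<psi> z)"
proof -
  have img: "cnj ` (- \<real>\<^sub>\<le>\<^sub>0) = - \<real>\<^sub>\<le>\<^sub>0"
  proof safe
    fix z :: complex assume "z \<notin> \<real>\<^sub>\<le>\<^sub>0"
    then show "z \<in> cnj ` (- \<real>\<^sub>\<le>\<^sub>0)"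
      by (intro image_eqI[of _ _ "cnj z"]) (auto simp: complex_nonpos_Reals_iff)
  qed (auto simp: complex_nonpos_Reals_iff)
  have "cnj (\<psi> (cnj z)) = \<psi> z"
  proof (rule slit_plane_identity[OF _ hol _ z])
    show "(\<lambda>z. cnj (\<psi> (cnj z))) holomorphic_on - \<real>\<^sub>\<le>\<^sub>0"
      using holomorphic_on_compose_cnj_cnj[of \<psi> "- \<real>\<^sub>\<le>\<^sub>0"] hol
      by (simp add: img open_Compl o_def)
  qed (use re in \<open>auto simp: Reals_cnj_iff\<close>)
  then show ?thesis by (metis complex_cnj_cnj)
qed

text \<open>Reflection carries the sign condition to the lower half-plane. The product form covers
  both half-planes at once, as the disc representation requires.\<close>

lemma stieltjes_S_sign:
  assumes "\<psi> \<in> stieltjes_S" and z: "z \<notin> \<real>\<^sub>\<le>\<^sub>0"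
  shows "Im z * Im (\<psi> z) \<le> 0"
proof -
  have refl: "\<psi> (cnj z) = cnj (\<psi> z)"
    by (rule slit_plane_reflection[OF _ _ z]) (use assms(1) in \<open>auto simp: stieltjes_S_def\<close>)
  have im: "\<And>z. z \<notin> \<real>\<^sub>\<le>\<^sub>0 \<Longrightarrow> 0 \<le> Im z \<Longrightarrow> Im (\<psi> z) \<le> 0"
    using assms(1) by (auto simp: stieltjes_S_def)
  show ?thesis
  proof (cases "0 \<le> Im z")
    case True
    then show ?thesis using im[OF z] by (simp add: mult_nonneg_nonpos)
  next
    case False
    have "cnj z \<notin> \<real>\<^sub>\<le>\<^sub>0" using z by (auto simp: complex_nonpos_Reals_iff)
    then have "0 \<le> Im (\<psi> z)" using im[of "cnj z"] False by (simp add: refl)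
    then show ?thesis using False by (simp add: mult_nonpos_nonneg)
  qed
qed

section \<open>Representation of the class S by a positive measure\<close>

text \<open>The conformal map \<open>u \<mapsto> ((1 + u) / (1 - u))\<^sup>2\<close> of the unit disc onto the slit plane
  sends \<open>(\<surd>x - 1) / (\<surd>x + 1)\<close> to \<open>x\<close>.\<close>

lemma stieltjes_S_representation_at_1:
  assumes \<psi>: "\<psi> \<in> stieltjes_S"
  shows "\<exists>\<mu> K. real_distribution \<mu> \<and> (AE s in \<mu>. s \<in> {0..1}) \<and> 0 \<le> K \<and>
    (\<forall>x>0. Re (\<psi> (of_real x)) = Re (\<psi> 1) - K * (\<integral>s. (x - 1) / (1 + s * (x - 1)) \<partial>\<mu>))"
proof -
  \<comment> \<open>Cayley transform to the right half-plane. As \<open>Re (q u) > 0\<close>, the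
    square avoids the cut and its imaginary part is a positive multiple of \<open>Im u\<close>, so
    the sign condition passes to \<open>H\<close>.\<close>
  define q :: "complex \<Rightarrow> complex" where "q u = (1 + u) / (1 - u)" for u
  have Req: "0 < Re (q u)" and Imq: "Im (q u) = Im u * (2 / (norm (1 - u))\<^sup>2)"
    and qn: "0 < (norm (1 - u))\<^sup>2" if "norm u < 1" for u
  proof -
    have n: "u \<noteq> 1" using that by auto
    have "(Re u)\<^sup>2 + (Im u)\<^sup>2 < 1"
      using that by (simp add: cmod_def)
    moreover have *: "(1 - Re u)\<^sup>2 + (Im u)\<^sup>2 = (norm (1 - u))\<^sup>2" by (simp add: cmod_power2)
    moreover show p: "0 < (norm (1 - u))\<^sup>2" using n by simp
    moreover have "Re (q u) = (1 - (Re u)\<^sup>2 - (Im u)\<^sup>2) / (norm (1 - u))\<^sup>2"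
      unfolding q_def Re_divide *[symmetric] by (simp add: power2_eq_square algebra_simps)
    ultimately show "0 < Re (q u)" by simp
    show "Im (q u) = Im u * (2 / (norm (1 - u))\<^sup>2)"
      unfolding q_def Im_divide *[symmetric] by (simp add: power2_eq_square algebra_simps)
  qed
  have Imq2: "Im ((q u)\<^sup>2) = 2 * Re (q u) * Im (q u)" for u by (simp add: power2_eq_square)
  have qslit: "(q u)\<^sup>2 \<notin> \<real>\<^sub>\<le>\<^sub>0" if "norm u < 1" for u
  proof
    assume "(q u)\<^sup>2 \<in> \<real>\<^sub>\<le>\<^sub>0"
    then have "Re ((q u)\<^sup>2) \<le> 0" "Im ((q u)\<^sup>2) = 0" by (auto simp: complex_nonpos_Reals_iff)
    then show False using Req[OF that] Imq2[of u] by (auto simp: power2_eq_square)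
      (metis mult_pos_pos not_less)
  qed
  define H where "H u = \<psi> ((q u)\<^sup>2)" for u
  have Hhol: "H holomorphic_on ball 0 1"
    unfolding H_def
    by (rule holomorphic_on_compose_gen[of _ _ \<psi> "- \<real>\<^sub>\<le>\<^sub>0", unfolded o_def])
       (use \<psi> qslit in \<open>auto simp: q_def stieltjes_S_def intro!: holomorphic_intros\<close>)
  have Hsgn: "Im u * Im (H u) \<le> 0" if "norm u < 1" for u
  proof -
    define k where "k = 2 * Re (q u) * (2 / (norm (1 - u))\<^sup>2)"
    have "0 < k" using Req[OF that] qn[OF that] by (simp add: k_def)
    moreover have "Im ((q u)\<^sup>2) * Im (H u) \<le> 0"
      unfolding H_def by (rule stieltjes_S_sign[OF \<psi> qslit[OF that]])
    moreover have "Im ((q u)\<^sup>2) = k * Im u" by (simp add: Imq2 Imq[OF that] k_def)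
    ultimately have "k * (Im u * Im (H u)) \<le> k * 0" by (simp add: mult.assoc)
    then show ?thesis using \<open>0 < k\<close> mult_le_cancel_left_pos by blast
  qed
  note rep = disc_representation_limit[OF Hhol Hsgn]
  obtain \<mu> where \<mu>: "real_distribution \<mu>" "AE s in \<mu>. s \<in> {0..1}"
    "\<And>w::real. \<bar>w\<bar> < 1 \<Longrightarrow>
       Re (H w) = Re (H 0) + Re (deriv H 0) * (\<integral>s. w / ((1 - w)\<^sup>2 + 4 * s * w) \<partial>\<mu>)"
    using rep(2) by blast
  have "Re (\<psi> (of_real x)) = Re (\<psi> 1) - (- Re (deriv H 0) / 4) * (\<integral>s. (x - 1) / (1 + s * (x - 1)) \<partial>\<mu>)"
    if x: "0 < x" for x
  proof -
    define y where "y = sqrt x"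
    have y: "0 < y" "x = y\<^sup>2" using x by (auto simp: y_def)
    define w where "w = (y - 1) / (y + 1)"
    have w: "\<bar>w\<bar> < 1" using y by (simp add: w_def abs_less_iff pos_divide_less_eq pos_less_divide_eq)
    have w1: "1 + w = 2 * y / (y + 1)" "1 - w = 2 / (y + 1)"
      using y by (simp_all add: w_def divide_simps)
    have "(1 + w) / (1 - w) = y" unfolding w1 using y by simp
    then have qw: "q w = y" unfolding q_def by (metis of_real_1 of_real_add of_real_diff of_real_divide)
    \<comment> \<open>The disc kernel becomes the Stieltjes kernel up to the factor
      \<open>1 / 4\<close>, the origin of the constant \<open>- Re (deriv H 0) / 4\<close>.\<close>
    have "w / ((1 - w)\<^sup>2 + 4 * s * w) = (x - 1) / (1 + s * (x - 1)) / 4" for s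
    proof -
      have "(1 - w)\<^sup>2 + 4 * s * w = 4 * (1 + s * (x - 1)) / (y + 1)\<^sup>2"
        unfolding w1 using y by (simp add: w_def divide_simps) (simp add: power2_eq_square algebra_simps)
      moreover have "w = (x - 1) / (y + 1)\<^sup>2"
        using y by (simp add: w_def divide_simps) (simp add: power2_eq_square algebra_simps)
      ultimately show ?thesis using y by simp
    qed
    then have "Re (H w) = Re (H 0) + Re (deriv H 0) * ((\<integral>s. (x - 1) / (1 + s * (x - 1)) \<partial>\<mu>) / 4)"
      using \<mu>(3)[OF w] by (simp only: integral_divide_zero)
    moreover have "H w = \<psi> (of_real x)" unfolding H_def qw y(2) by simp
    moreover have "H 0 = \<psi> 1" by (simp add: H_def q_def)
    ultimately show ?thesis by simp
  qed
  moreover have "0 \<le> - Re (deriv H 0) / 4" using rep(1) by simp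
  ultimately show ?thesis using \<mu>(1,2) by blast
qed

text \<open>The denominator is the convex combination of \<open>1\<close> and \<open>x\<close> with
  weight \<open>s\<close> on \<open>x\<close>.\<close>

lemma stieltjes_kernel_bounds:
  fixes s x :: real
  assumes "0 \<le> s" "s \<le> 1" "0 < x"
  shows "min 1 x \<le> 1 + s * (x - 1)" "0 < 1 + s * (x - 1)"
proof -
  have "1 + s * (x - 1) = (1 - s) * 1 + s * x" by (simp add: algebra_simps)
  also have "\<dots> \<ge> (1 - s) * min 1 x + s * min 1 x"
    using assms by (intro add_mono mult_left_mono) auto
  finally show "min 1 x \<le> 1 + s * (x - 1)" by (simp add: algebra_simps)
  then show "0 < 1 + s * (x - 1)" using assms(3) by linarith
qed

text \<open>Letting \<open>x \<longrightarrow> \<infinity>\<close> in the representation anchored at \<open>1\<close>, positivity of \<open>\<psi>\<close> and Fatou's lemma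
  bound \<open>\<integral> K / s\<close> by \<open>\<psi> 1\<close>; the defect is the constant \<open>a\<close>.\<close>

lemma stieltjes_S_representation:
  assumes \<psi>: "\<psi> \<in> stieltjes_S"
  shows "\<exists>a N. 0 \<le> a \<and> finite_measure N \<and> sets N = sets borel \<and> (AE s in N. s \<in> {0<..1}) \<and>
    (\<forall>x>0. \<psi> (of_real x) = of_real (a + (\<integral>s. 1 / (1 + s * (x - 1)) \<partial>N)))"
proof -
  obtain \<mu> K where \<mu>: "real_distribution \<mu>" and \<mu>01: "AE s in \<mu>. s \<in> {0..1}" and K: "0 \<le> K"
    and rep: "\<And>x. 0 < x \<Longrightarrow> Re (\<psi> (of_real x)) = Re (\<psi> 1) - K * (\<integral>s. (x - 1) / (1 + s * (x - 1)) \<partial>\<mu>)"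
    using stieltjes_S_representation_at_1[OF \<psi>] by blast
  interpret real_distribution \<mu> by fact
  define c where "c = Re (\<psi> 1)"
  have pos: "0 < Re (\<psi> (of_real x))" and real: "\<psi> (of_real x) = of_real (Re (\<psi> (of_real x)))"
    if "0 < x" for x
    using \<psi> that by (auto simp: stieltjes_S_def)
  have c0: "0 \<le> c" using pos[of 1] by (simp add: c_def)
  show ?thesis
  proof (cases "K = 0")
    \<comment> \<open>Here \<psi> is constant on the positive axis, represented by
      \<open>a = c\<close> and the zero measure.\<close>
    case True
    have "finite_measure (null_measure borel :: real measure)" by (rule finite_measureI) simp
    moreover have "AE s in (null_measure borel :: real measure). s \<in> {0<..1}"
      by (rule AE_I[of _ _ UNIV]) auto
    moreover have "\<psi> (of_real x) = of_real (c + (\<integral>s. 1 / (1 + s * (x - 1)) \<partial>(null_measure borel)))" if "0 < x" for x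
      using real[OF that] rep[OF that] True by (simp add: c_def)
    ultimately show ?thesis using c0 by (intro exI[of _ c] exI[of _ "null_measure borel"]) auto
  next
    case False
    then have Kpos: "0 < K" using K by simp
    \<comment> \<open>\<open>g n\<close> is \<open>K\<close> times the kernel at
      \<open>x = 1 + n\<close>. It tends to \<open>K / s\<close> for \<open>s > 0\<close>, while
      \<open>g n 0 = K * n\<close> is unbounded.\<close>
    define g where "g n s = K * (real n / (1 + s * real n))" for n s
    have gm[measurable]: "g n \<in> borel_measurable borel" for n unfolding g_def by measurable
    have g0: "AE s in \<mu>. 0 \<le> g n s" for n
      using \<mu>01 by eventually_elim (use Kpos in \<open>auto simp: g_def\<close>)
    have gb: "AE s in \<mu>. norm (g n s) \<le> K * real n" for n
      using \<mu>01
    proof eventually_elim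
      case (elim s)
      have "real n / (1 + s * real n) \<le> real n / 1"
        using elim by (intro divide_left_mono) (auto intro!: add_pos_nonneg)
      then have "K * (real n / (1 + s * real n)) \<le> K * (real n / 1)"
        by (rule mult_left_mono[OF _ K])
      moreover have "0 \<le> K * (real n / (1 + s * real n))" using elim K by simp
      ultimately show ?case by (simp only: g_def real_norm_def abs_of_nonneg div_by_1)
    qed
    have gi: "integrable \<mu> (g n)" for n
      by (rule integrable_const_bound[OF gb]) measurable
    have gle: "(\<integral>s. g n s \<partial>\<mu>) \<le> c" for n
    proof -
      have "(\<integral>s. g n s \<partial>\<mu>) = K * (\<integral>s. real n / (1 + s * real n) \<partial>\<mu>)"
        unfolding g_def by (rule integral_mult_right_zero)
      then show ?thesis using rep[of "1 + real n"] pos[of "1 + real n"] by (simp add: c_def)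
    qed
    \<comment> \<open>The limit is taken in the extended nonnegative reals, so that
      \<open>s = 0\<close> receives the value infinity.\<close>
    define G where "G s = liminf (\<lambda>n. ennreal (g n s))" for s
    have Gm[measurable]: "G \<in> borel_measurable borel" unfolding G_def by measurable
    have "(\<integral>\<^sup>+s. G s \<partial>\<mu>) \<le> liminf (\<lambda>n. \<integral>\<^sup>+s. ennreal (g n s) \<partial>\<mu>)"
      unfolding G_def by (rule nn_integral_liminf) measurable
    also have "\<dots> \<le> liminf (\<lambda>n. ennreal c)"
      using gle by (intro Liminf_mono always_eventually allI)
        (simp add: nn_integral_eq_integral[OF gi g0] ennreal_leI)
    also have "\<dots> = ennreal c" by (rule Liminf_const) simp
    finally have Gle: "(\<integral>\<^sup>+s. G s \<partial>\<mu>) \<le> ennreal c" .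
    have Gfin: "AE s in \<mu>. G s \<noteq> \<infinity>"
      by (rule nn_integral_PInf_AE) (use Gle in \<open>auto simp: top_unique\<close>)
    have G0: "G 0 = \<infinity>"
    proof -
      have "filterlim (\<lambda>n. K * real n) at_top sequentially"
        using Kpos by (intro filterlim_tendsto_pos_mult_at_top[OF tendsto_const] filterlim_real_sequentially)
      then have "(\<lambda>n. ennreal (K * real n)) \<longlonglongrightarrow> \<infinity>"
        by (simp add: ennreal_tendsto_top_eq_at_top infinity_ennreal_def)
      then have "(\<lambda>n. ennreal (g n 0)) \<longlonglongrightarrow> \<infinity>" by (simp add: g_def)
      then show ?thesis unfolding G_def by (simp add: lim_imp_Liminf)
    qed
    \<comment> \<open>\<open>G\<close> has finite integral but is infinite at \<open>0\<close>, so
      \<mu> has no atom there. Only then is \<open>K / s\<close> the limit almost everywhere, since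
      \<open>K / 0 = 0\<close> by convention.\<close>
    have \<mu>pos: "AE s in \<mu>. s \<in> {0<..1}"
      using Gfin \<mu>01
    proof eventually_elim
      case (elim s)
      then show ?case using G0 by (cases "s = 0") auto
    qed
    have Geq: "AE s in \<mu>. G s = ennreal (K / s)"
      using \<mu>pos
    proof eventually_elim
      case (elim s)
      have "((\<lambda>n. K * (real n / (1 + s * real n))) \<longlongrightarrow> K * (1 / s)) sequentially"
      proof (intro tendsto_mult tendsto_const)
        have "(\<lambda>n. 1 / (inverse (real n) + s)) \<longlonglongrightarrow> 1 / (0 + s)"
          using elim by (intro tendsto_intros lim_inverse_n) auto
        moreover have "\<forall>\<^sub>F n in sequentially. 1 / (inverse (real n) + s) = real n / (1 + s * real n)"
          using eventually_gt_at_top[of 0] by eventually_elim (simp add: field_simps)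
        ultimately show "(\<lambda>n. real n / (1 + s * real n)) \<longlonglongrightarrow> 1 / s"
          by (simp add: tendsto_cong)
      qed
      then have "(\<lambda>n. ennreal (g n s)) \<longlonglongrightarrow> ennreal (K / s)"
        unfolding g_def by (intro tendsto_ennrealI) simp
      then show ?case unfolding G_def by (simp add: lim_imp_Liminf)
    qed
    have nnK: "AE s in \<mu>. 0 \<le> K / s" using \<mu>pos by eventually_elim (use K in auto)
    have nnle: "(\<integral>\<^sup>+s. ennreal (K / s) \<partial>\<mu>) \<le> ennreal c"
      using Gle nn_integral_cong_AE[OF Geq] by simp
    have Ki: "integrable \<mu> (\<lambda>s. K / s)"
      by (rule integrableI_nonneg[OF _ nnK]) (use nnle in \<open>auto simp: order.strict_trans1\<close>)
    have Kle: "(\<integral>s. K / s \<partial>\<mu>) \<le> c"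
      using nnle c0 unfolding nn_integral_eq_integral[OF Ki nnK] by simp
    \<comment> \<open>The weight \<open>K / s\<close> passes from the kernel anchored at
      \<open>1\<close> to the Stieltjes kernel: with \<open>q = 1 + s * (x - 1)\<close>, one has
      \<open>K * (x - 1) / q = K / s - (K / s) / q\<close>.\<close>
    define N where "N = density \<mu> (\<lambda>s. ennreal (K / s))"
    have "finite_measure N"
      by (rule finite_measureI) (use nnle in \<open>auto simp: N_def emeasure_density top_unique\<close>)
    moreover have "sets N = sets borel" by (simp add: N_def)
    moreover have "AE s in N. s \<in> {0<..1}"
      unfolding N_def using \<mu>pos by (subst AE_density) (auto elim: AE_mp)
    moreover have "\<psi> (of_real x) = of_real ((c - (\<integral>s. K / s \<partial>\<mu>)) + (\<integral>s. 1 / (1 + s * (x - 1)) \<partial>N))"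
      if x: "0 < x" for x
    proof -
      have i2: "integrable \<mu> (\<lambda>s. (K / s) * (1 / (1 + s * (x - 1))))"
      proof (rule Bochner_Integration.integrable_bound)
        show "integrable \<mu> (\<lambda>s. (1 / min 1 x) * (K / s))" using Ki by (rule integrable_mult_right)
        show "AE s in \<mu>. norm ((K / s) * (1 / (1 + s * (x - 1)))) \<le> norm ((1 / min 1 x) * (K / s))"
          using \<mu>pos
        proof eventually_elim
          case (elim s)
          then have "1 / (1 + s * (x - 1)) \<le> 1 / min 1 x"
            using stieltjes_kernel_bounds[of s x] x by (intro divide_left_mono) auto
          moreover have *: "0 \<le> K / s" "0 < 1 / (1 + s * (x - 1))"
            using elim K stieltjes_kernel_bounds[of s x] x by auto
          ultimately have "(K / s) * (1 / (1 + s * (x - 1))) \<le> (1 / min 1 x) * (K / s)"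
            by (subst mult.commute[of "1 / min 1 x"]) (intro mult_left_mono)
          also have "\<dots> \<le> norm ((1 / min 1 x) * (K / s))"
            by (simp only: real_norm_def abs_ge_self)
          finally have "(K / s) * (1 / (1 + s * (x - 1))) \<le> norm ((1 / min 1 x) * (K / s))" .
          moreover have "0 \<le> (K / s) * (1 / (1 + s * (x - 1)))"
            using * by (intro mult_nonneg_nonneg) auto
          ultimately show ?case by (subst real_norm_def) (simp only: abs_of_nonneg)
        qed
      qed measurable
      have "(\<integral>s. 1 / (1 + s * (x - 1)) \<partial>N) = (\<integral>s. (K / s) * (1 / (1 + s * (x - 1))) \<partial>\<mu>)"
        unfolding N_def by (subst integral_density[OF _ _ nnK]) auto
      then have "(\<integral>s. K / s \<partial>\<mu>) - (\<integral>s. 1 / (1 + s * (x - 1)) \<partial>N)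
         = (\<integral>s. K / s - (K / s) * (1 / (1 + s * (x - 1))) \<partial>\<mu>)"
        using Ki i2 by simp
      also have "\<dots> = (\<integral>s. K * ((x - 1) / (1 + s * (x - 1))) \<partial>\<mu>)"
      proof (rule integral_cong_AE)
        show "AE s in \<mu>. K / s - (K / s) * (1 / (1 + s * (x - 1))) = K * ((x - 1) / (1 + s * (x - 1)))"
          using \<mu>pos
        proof eventually_elim
          case (elim s)
          define q where "q = 1 + s * (x - 1)"
          have q: "q \<noteq> 0" using elim stieltjes_kernel_bounds(2)[of s x] x by (auto simp: q_def)
          have "x - 1 = (q - 1) / s" using elim by (simp add: q_def)
          moreover have "K / s - (K / s) * (1 / q) = K * ((q - 1) / s / q)"
            using elim q by (simp add: divide_simps) (simp add: algebra_simps)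
          ultimately show ?case by (simp only: q_def)
        qed
      qed measurable
      also have "\<dots> = c - Re (\<psi> (of_real x))"
        unfolding integral_mult_right_zero c_def using rep[OF x] by linarith
      finally have R: "Re (\<psi> (of_real x)) = (c - (\<integral>s. K / s \<partial>\<mu>)) + (\<integral>s. 1 / (1 + s * (x - 1)) \<partial>N)"
        by linarith
      show ?thesis by (subst real[OF x]) (simp only: R)
    qed
    moreover have "0 \<le> c - (\<integral>s. K / s \<partial>\<mu>)" using Kle by simp
    ultimately show ?thesis by blast
  qed
qed

section \<open>Exponential generating functions of moments\<close>

text \<open>Sum and integral are exchanged because the terms are dominated by
  \<open>norm z ^ k / fact k\<close>. This serves twice: for the powers \<open>u ^ k\<close> inside
  one kernel, and for \<open>1 / (1 + s * k)\<close> when kernels are mixed.\<close>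

lemma exp_generating_integral:
  fixes h :: "nat \<Rightarrow> 'a \<Rightarrow> real" and z :: complex
  assumes "finite_measure M" and h[measurable]: "\<And>k. h k \<in> borel_measurable M"
    and h1: "AE x in M. \<forall>k. \<bar>h k x\<bar> \<le> 1"
  shows "(\<lambda>k. of_real (\<integral>x. h k x \<partial>M) / fact k * z ^ k) sums (\<integral>x. (\<Sum>k. of_real (h k x) / fact k * z ^ k) \<partial>M)"
    and "integrable M (\<lambda>x. \<Sum>k. of_real (h k x) / fact k * z ^ k)"
proof -
  interpret finite_measure M by fact
  let ?f = "\<lambda>k x. of_real (h k x) / fact k * z ^ k"
  have bnd: "norm (?f k x) \<le> norm z ^ k / fact k" if "\<bar>h k x\<bar> \<le> 1" for k x
    using that mult_right_mono[of "\<bar>h k x\<bar>" 1 "norm z ^ k / fact k"]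
    by (simp add: norm_mult norm_divide norm_power)
  have sexp: "summable (\<lambda>k. norm z ^ k / fact k)"
    using summable_exp[of "norm z"] by (simp add: divide_inverse mult.commute)
  have int: "integrable M (?f k)" for k
    by (rule integrable_const_bound[of _ "norm z ^ k / fact k"]) (use h1 bnd in auto)
  have ae: "AE x in M. summable (\<lambda>k. norm (?f k x))"
    using h1
  proof eventually_elim
    case (elim x)
    show ?case by (rule summable_comparison_test'[OF sexp, of 0]) (use bnd elim in auto)
  qed
  have sm: "summable (\<lambda>k. \<integral>x. norm (?f k x) \<partial>M)"
  proof (rule summable_comparison_test'[OF summable_mult[OF sexp, of "measure M (space M)"], of 0])
    fix k
    have "(\<integral>x. norm (?f k x) \<partial>M) \<le> (\<integral>x. norm z ^ k / fact k \<partial>M)"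
      by (rule integral_mono_AE) (use int h1 bnd in auto)
    moreover have "0 \<le> (\<integral>x. norm (?f k x) \<partial>M)" by simp
    ultimately show "norm (\<integral>x. norm (?f k x) \<partial>M) \<le> measure M (space M) * (norm z ^ k / fact k)"
      by (simp add: mult.commute)
  qed
  have "(\<lambda>k. \<integral>x. ?f k x \<partial>M) sums (\<integral>x. (\<Sum>k. ?f k x) \<partial>M)"
    by (rule sums_integral[OF int ae sm])
  then show "(\<lambda>k. of_real (\<integral>x. h k x \<partial>M) / fact k * z ^ k) sums (\<integral>x. (\<Sum>k. ?f k x) \<partial>M)"
    by (simp add: mult.assoc)
  show "integrable M (\<lambda>x. \<Sum>k. ?f k x)"
    by (rule integrable_suminf[OF int ae sm])
qed

section \<open>Positivity of the kernel series in the right half-plane\<close>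

lemma Re_exp_uminus_le_1: "0 \<le> Re z \<Longrightarrow> 0 \<le> v \<Longrightarrow> Re (exp (- (z * of_real v))) \<le> 1"
  using complex_Re_le_cmod[of "exp (- (z * of_real v))"] by (force intro: order.trans)

text \<open>Rigidity behind strict positivity: a point of the closed unit disc with real part
  \<open>1\<close> equals \<open>1\<close>, so the exponent is a multiple of
  \<open>2 * pi * \<i>\<close>, and on a short segment that multiple is \<open>0\<close>.\<close>

lemma exp_segment_eq_1_imp_0:
  assumes "0 \<le> Re z" and eq: "\<And>v. 0 \<le> v \<Longrightarrow> v \<le> 1 / 2 \<Longrightarrow> Re (exp (- (z * of_real v))) = 1"
  shows "z = 0"
proof (rule ccontr)
  assume z: "z \<noteq> 0"
  \<comment> \<open>\<open>1 / 2\<close> keeps \<open>v\<close> in the range of the hypothesis;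
    \<open>1 / norm z\<close> bounds the exponent by \<open>1\<close>, below
    \<open>2 * pi\<close>.\<close>
  define v where "v = min (1 / 2) (1 / norm z)"
  have v: "0 < v" "v \<le> 1 / 2" "v \<le> 1 / norm z" using z by (auto simp: v_def)
  define w where "w = - (z * of_real v)"
  have "norm w = norm z * v" using v by (simp add: w_def norm_mult)
  also have "\<dots> \<le> norm z * (1 / norm z)" using v by (intro mult_left_mono) auto
  finally have wn: "norm w \<le> 1" using z by simp
  have "Re (exp w) = 1" using eq[of v] v by (simp add: w_def)
  moreover have "norm (exp w) \<le> 1" using assms(1) v by (simp add: w_def)
  ultimately have "exp w = 1"
    using cmod_power2[of "exp w"] power_mono[of "norm (exp w)" 1 2] by (auto simp: complex_eq_iff)
  then obtain n :: int where "Re w = 0" and n: "Im w = of_int (2 * n) * pi"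
    unfolding exp_eq_1 by auto
  have "\<bar>of_int (2 * n) * pi\<bar> \<le> 1" using abs_Im_le_cmod[of w] wn n by linarith
  moreover have "\<bar>of_int (2 * n) * pi\<bar> \<ge> 2 * pi" if "n \<noteq> 0"
  proof -
    have "1 \<le> \<bar>real_of_int n\<bar>" using that by linarith
    then have "1 * pi \<le> \<bar>real_of_int n\<bar> * pi" by (intro mult_right_mono) auto
    then show ?thesis by (simp add: abs_mult)
  qed
  ultimately have "n = 0" using pi_gt3 by force
  then have "w = 0" using n \<open>Re w = 0\<close> by (simp add: complex_eq_iff)
  then show False using z v by (simp add: w_def)
qed

text \<open>Integration by parts: \<open>u powr t * (exp (- z (1 - u)) - 1)\<close> vanishes at both endpoints.\<close>

lemma powr_exp_integral:
  fixes t :: real and z :: complex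
  assumes t: "0 < t" and z: "0 \<le> Re z"
    and I: "((\<lambda>u. u powr t * Re (z * exp (- (z * of_real (1 - u))))) has_integral I) {0..1}"
  shows "0 \<le> I" and "z \<noteq> 0 \<Longrightarrow> 0 < I"
proof -
  define e where "e u = Re (exp (- (z * of_real (1 - u))))" for u
  \<comment> \<open>What integration by parts leaves: the derivative of the increasing weight times
    \<open>1 - e u\<close>, nonnegative on \<open>[0, 1]\<close> since \<open>e u \<le> 1\<close>
    there.\<close>
  define p where "p u = t * u powr (t - 1) * (1 - e u)" for u
  have econt: "continuous_on A e" for A unfolding e_def by (intro continuous_intros)
  have e': "(e has_real_derivative Re (z * exp (- (z * of_real (1 - u))))) (at u)" for u
  proof -
    have "((\<lambda>w. exp (- (z * (1 - w)))) has_field_derivative z * exp (- (z * (1 - of_real u)))) (at (of_real u))"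
      by (auto intro!: derivative_eq_intros)
    from has_vector_derivative_real_field[OF this]
    have "((\<lambda>u. exp (- (z * of_real (1 - u)))) has_vector_derivative z * exp (- (z * of_real (1 - u)))) (at u)"
      by simp
    then show ?thesis unfolding e_def has_real_derivative_iff_has_vector_derivative
      by (rule bounded_linear.has_vector_derivative[OF bounded_linear_Re])
  qed
  have "((\<lambda>u. u powr t * Re (z * exp (- (z * of_real (1 - u)))) - p u) has_integral
      (1 powr t * (e 1 - 1) - 0 powr t * (e 0 - 1))) {0..1}"
  \<comment> \<open>For \<open>t < 1\<close> the weight is not differentiable at \<open>0\<close>,
    so only continuity is used at the endpoints.\<close>
  proof (rule fundamental_theorem_of_calculus_interior)
    show "continuous_on {0..1} (\<lambda>u. u powr t * (e u - 1))"
      using t by (intro continuous_intros continuous_on_powr' econt) auto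
    fix u :: real assume u: "u \<in> {0<..<1}"
    have "((\<lambda>u. u powr t * (e u - 1)) has_real_derivative
       u powr t * Re (z * exp (- (z * of_real (1 - u)))) - p u) (at u)"
      using u by (auto intro!: derivative_eq_intros e' simp: p_def algebra_simps)
    then show "((\<lambda>u. u powr t * (e u - 1)) has_vector_derivative
       u powr t * Re (z * exp (- (z * of_real (1 - u)))) - p u) (at u)"
      by (simp add: has_real_derivative_iff_has_vector_derivative)
  qed auto
  from has_integral_diff[OF I this] have pI: "(p has_integral I) {0..1}"
    using t by (simp add: e_def)
  have p0: "0 \<le> p u" if "u \<in> {0..1}" for u
    using Re_exp_uminus_le_1[OF z, of "1 - u"] that t by (simp add: p_def e_def)
  show I0: "0 \<le> I" using has_integral_nonneg[OF pI] p0 by auto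
  show "0 < I" if "z \<noteq> 0"
  proof (rule ccontr)
    assume "\<not> 0 < I"
    then have "(p has_integral 0) {0..1}" using I0 pI by simp
    \<comment> \<open>Near \<open>0\<close> the function \<open>p\<close> may be unbounded, so its
      vanishing is deduced on \<open>[1/2, 1]\<close>, where it is continuous.\<close>
    moreover have pc: "continuous_on {1/2..1} p"
      unfolding p_def by (intro continuous_intros econt) auto
    ultimately have "integral {1/2..1} p \<le> 0"
      using integral_subset_le[of "{1/2..1}" "{0..1}" p] p0
      by (auto simp: integrable_continuous_interval has_integral_iff)
    moreover have "0 \<le> integral {1/2..1} p" by (rule integral_nonneg) (use pc p0 in \<open>auto simp: integrable_continuous_interval\<close>)
    ultimately have "(p has_integral 0) {1/2..1}"
      using integrable_integral[OF integrable_continuous_interval[OF pc]] by simp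
    then have "p u = 0" if "u \<in> {1/2..1}" for u
      using has_integral_0_cbox_imp_0[of "1/2" 1 p u] pc p0 that by auto
    then have "e u = 1" if "u \<in> {1/2..1}" for u
      using t that by (auto simp: p_def)
    from this[of "1 - v" for v] have "Re (exp (- (z * of_real v))) = 1" if "0 \<le> v" "v \<le> 1/2" for v
      using that by (simp add: e_def)
    then show False using exp_segment_eq_1_imp_0[OF z] \<open>z \<noteq> 0\<close> by blast
  qed
qed

text \<open>For \<open>0 < s < 1\<close> put \<open>t = (1 - s) / s\<close>. The moments of
  \<open>u powr t\<close> on \<open>[0, 1]\<close> are
  \<open>1 / (t + k + 1) = s / (1 + s * k)\<close>, so \<open>s * G\<close> is the integral of
  \<open>u powr t * exp (z * u)\<close>, and the factor \<open>z * exp (- z)\<close> produces the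
  integral just estimated. The end cases are explicit: \<open>s = 0\<close> gives \<open>z\<close>,
  \<open>s = 1\<close> gives \<open>1 - exp (- z)\<close>. Their real parts can vanish on the
  imaginary axis, so strictness is claimed only inside.\<close>

lemma stieltjes_kernel_series:
  fixes s :: real and z :: complex
  assumes s: "0 \<le> s" "s \<le> 1" and z: "0 \<le> Re z"
  defines "G \<equiv> (\<Sum>k. of_real (1 / (1 + s * real k)) / fact k * z ^ k)"
  shows "0 \<le> Re (z * exp (- z) * G)" and "0 < s \<Longrightarrow> s < 1 \<Longrightarrow> z \<noteq> 0 \<Longrightarrow> 0 < Re (z * exp (- z) * G)"
proof -
  have gt: "0 \<le> Re (z * exp (- z) * G) \<and> (z \<noteq> 0 \<longrightarrow> 0 < Re (z * exp (- z) * G))" if s': "0 < s" "s < 1"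
  proof -
    define t where "t = (1 - s) / s"
    have t: "0 < t" using s' by (simp add: t_def)
    define w where "w u = indicator {0..1} u * u powr t" for u :: real
    have w0: "0 \<le> w u" for u by (simp add: w_def)
    have wm[measurable]: "w \<in> borel_measurable borel" unfolding w_def by measurable
    define M where "M = density lborel (\<lambda>u. ennreal (w u))"
    have pc: "continuous_on {0..1} (\<lambda>u::real. u powr t)"
      using t by (intro continuous_on_powr' continuous_intros) auto
    have IM: "(\<integral>u. g u \<partial>M) = I"
      if g: "continuous_on {0..1} g" "g \<in> borel_measurable borel" and I: "((\<lambda>u. u powr t * g u) has_integral I) {0..1}"
      for g :: "real \<Rightarrow> real" and I
    proof -
      have "(\<integral>u. g u \<partial>M) = (\<integral>u. w u * g u \<partial>lborel)"
        unfolding M_def by (subst integral_density) (use g w0 in auto)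
      also have "\<dots> = (\<integral>u. indicator {0..1} u * (u powr t * g u) \<partial>lborel)"
        by (simp add: w_def mult.assoc)
      also have "\<dots> = I"
        by (rule has_integral_continuous_lborel(2)[OF _ I]) (intro continuous_intros pc g)
      finally show ?thesis .
    qed
    have pI: "((\<lambda>u. u powr (t + real k)) has_integral 1 / (t + real k + 1)) {0..1}" for k
      using has_integral_powr_from_0[of "t + real k" 1] t by simp
    have pk: "((\<lambda>u. u powr t * u ^ k) has_integral 1 / (t + real k + 1)) {0..1}" for k
    proof (rule has_integral_eq[OF _ pI])
      fix u :: real assume "u \<in> {0..1}"
      then show "u powr (t + real k) = u powr t * u ^ k"
        using t by (cases "u = 0") (auto simp: powr_add powr_realpow)
    qed
    have "finite_measure M"
    proof (rule finite_measureI)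
      have "emeasure M (space M) = (\<integral>\<^sup>+u. ennreal (w u) \<partial>lborel)"
        by (simp add: M_def emeasure_density)
      also have "\<dots> = ennreal (\<integral>u. w u \<partial>lborel)"
        using has_integral_continuous_lborel(1)[OF pc, of "1 / (t + 1)"] pI[of 0] w0
        by (intro nn_integral_eq_integral) (auto simp: w_def[abs_def])
      finally show "emeasure M (space M) \<noteq> \<infinity>" by simp
    qed
    moreover have M01: "AE u in M. u \<in> {0..1}"
      unfolding M_def by (subst AE_density) (auto simp: w_def indicator_def split: if_splits)
    then have "AE u in M. \<forall>k. \<bar>u ^ k\<bar> \<le> 1"
      by eventually_elim (auto simp: power_le_one)
    moreover have um: "(\<lambda>u. u ^ k) \<in> borel_measurable M" for k by (simp add: M_def)
    ultimately have sums: "(\<lambda>k. of_real (\<integral>u. u ^ k \<partial>M) / fact k * z ^ k) sums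
        (\<integral>u. (\<Sum>k. of_real (u ^ k) / fact k * z ^ k) \<partial>M)"
      and int: "integrable M (\<lambda>u. \<Sum>k. of_real (u ^ k) / fact k * z ^ k)"
      using exp_generating_integral[of M "\<lambda>k u. u ^ k" z] by auto
    have expz: "(\<Sum>k. of_real (u ^ k) / fact k * z ^ k) = exp (z * of_real u)" for u :: real
      by (simp add: exp_def scaleR_conv_of_real power_mult_distrib divide_inverse mult_ac)
    have "(\<integral>u. u ^ k \<partial>M) = s * (1 / (1 + s * real k))" for k
    proof -
      have "t + real k + 1 = (1 + s * real k) / s" using s' by (simp add: t_def field_simps)
      then show ?thesis
        using IM[OF _ _ pk[of k]] by (simp add: continuous_intros)
    qed
    then have "(\<lambda>k. of_real s * (of_real (1 / (1 + s * real k)) / fact k * z ^ k)) sums (\<integral>u. exp (z * of_real u) \<partial>M)"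
      using sums by (simp only: expz of_real_mult times_divide_eq_right[symmetric] mult.assoc)
    then have "(\<lambda>k. of_real (1 / (1 + s * real k)) / fact k * z ^ k) sums ((\<integral>u. exp (z * of_real u) \<partial>M) / of_real s)"
      by (rule sums_mult_D) (use s' in simp)
    then have "G = (\<integral>u. exp (z * of_real u) \<partial>M) / of_real s"
      unfolding G_def by (rule sums_unique[symmetric])
    moreover have kern: "(z * exp (- z)) * exp (z * of_real u) = z * exp (- (z * of_real (1 - u)))" for u
    proof -
      have "- (z * of_real (1 - u)) = - z + z * of_real u" by (simp add: algebra_simps)
      then show ?thesis by (simp only: exp_add mult.assoc)
    qed
    ultimately have "z * exp (- z) * G = (z * exp (- z)) * (\<integral>u. exp (z * of_real u) \<partial>M) / of_real s"
      by (simp only: times_divide_eq_right)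
    also have "(z * exp (- z)) * (\<integral>u. exp (z * of_real u) \<partial>M) = (\<integral>u. (z * exp (- z)) * exp (z * of_real u) \<partial>M)"
      by (rule integral_mult_right_zero[symmetric])
    also have "\<dots> = (\<integral>u. z * exp (- (z * of_real (1 - u))) \<partial>M)"
      by (simp only: kern)
    finally have "Re (z * exp (- z) * G) = Re (\<integral>u. z * exp (- (z * of_real (1 - u))) \<partial>M) / s" by simp
    also have "Re (\<integral>u. z * exp (- (z * of_real (1 - u))) \<partial>M) = (\<integral>u. Re (z * exp (- (z * of_real (1 - u)))) \<partial>M)"
    proof -
      have "integrable M (\<lambda>u. (z * exp (- z)) * exp (z * of_real u))"
        using int unfolding expz by (rule integrable_mult_right)
      also have "(\<lambda>u. (z * exp (- z)) * exp (z * of_real u)) = (\<lambda>u. z * exp (- (z * of_real (1 - u))))"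
        by (simp only: kern)
      finally show ?thesis by (rule integral_Re[symmetric])
    qed
    finally have eq: "Re (z * exp (- z) * G) = (\<integral>u. Re (z * exp (- (z * of_real (1 - u)))) \<partial>M) / s" .
    have cont: "continuous_on A (\<lambda>u. Re (z * exp (- (z * of_real (1 - u)))))" for A
      by (intro continuous_intros)
    have I: "((\<lambda>u. u powr t * Re (z * exp (- (z * of_real (1 - u))))) has_integral
       integral {0..1} (\<lambda>u. u powr t * Re (z * exp (- (z * of_real (1 - u)))))) {0..1}"
      by (intro integrable_integral integrable_continuous_interval continuous_on_mult pc cont)
    have "(\<integral>u. Re (z * exp (- (z * of_real (1 - u)))) \<partial>M) =
        integral {0..1} (\<lambda>u. u powr t * Re (z * exp (- (z * of_real (1 - u)))))"
      by (rule IM[OF cont _ I]) (intro borel_measurable_continuous_onI cont)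
    then show ?thesis
      unfolding eq using powr_exp_integral[OF t z I] s' by simp
  qed
  then show "0 < s \<Longrightarrow> s < 1 \<Longrightarrow> z \<noteq> 0 \<Longrightarrow> 0 < Re (z * exp (- z) * G)" by simp
  consider "s = 0" | "s = 1" | "0 < s" "s < 1" using s by linarith
  then show "0 \<le> Re (z * exp (- z) * G)"
  proof cases
    case 1
    have "G = exp z"
      unfolding G_def exp_def using 1 by (simp add: scaleR_conv_of_real divide_inverse mult.commute)
    then have "z * exp (- z) * G = z" by (simp add: exp_minus)
    then show ?thesis using z by (simp only:)
  next
    case 2
    \<comment> \<open>For \<open>s = 1\<close> the coefficients are \<open>1 / fact (k + 1)\<close>,
      so \<open>z * G\<close> is the exponential series without its constant term.\<close>
    have "(\<lambda>k. z ^ k /\<^sub>R fact k) sums exp z" by (rule exp_converges)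
    from sums_split_initial_segment[OF this, of 1]
    have s1: "(\<lambda>k. z ^ Suc k /\<^sub>R fact (Suc k)) sums (exp z - 1)" by simp
    have "z * G = exp z - 1"
    proof (cases "z = 0")
      case False
      have "z * (of_real (1 / (1 + s * real k)) / fact k * z ^ k) = z ^ Suc k /\<^sub>R fact (Suc k)" for k
        using 2 by (simp add: scaleR_conv_of_real field_simps)
      then have "(\<lambda>k. z * (of_real (1 / (1 + s * real k)) / fact k * z ^ k)) sums (exp z - 1)"
        using s1 by simp
      then have "G = (exp z - 1) / z"
        unfolding G_def by (intro sums_unique[symmetric] sums_mult_D[OF _ False])
      then show ?thesis using False by simp
    qed simp
    then have "z * exp (- z) * G = 1 - exp (- z)"
      by (simp add: mult.commute[of z] mult.assoc) (simp add: exp_minus field_simps)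
    then have "Re (z * exp (- z) * G) = 1 - Re (exp (- z))"
      by (simp only: minus_complex.sel one_complex.sel)
    then show ?thesis using Re_exp_uminus_le_1[OF z, of 1] by (simp del: times_complex.sel)
  next
    case 3
    then show ?thesis using gt by simp
  qed
qed

text \<open>\<open>F\<close> is the average over \<open>M\<close> of the kernel series, so the
  half-plane inequality is inherited. If the nonnegative integrand had integral zero, it would
  vanish almost everywhere, which is impossible once \<open>M\<close> charges the open interval,
  where each kernel is strict.\<close>

lemma moment_series:
  fixes M :: "real measure"
  assumes M: "finite_measure M" and [simp, measurable_cong]: "sets M = sets borel"
    and M01: "AE s in M. s \<in> {0..1}"
    and m: "\<And>k. m k = (\<integral>s. 1 / (1 + s * real k) \<partial>M)"
    and F: "\<And>z. F z = (\<Sum>k. of_real (m k) / fact k * z ^ k)"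
  shows "0 \<le> m k" and "m k \<le> measure M (space M)"
    and "(\<lambda>k. of_real (m k) / fact k * z ^ k) sums F z"
    and "0 \<le> Re z \<Longrightarrow> 0 \<le> Re (z * exp (- z) * F z)"
    and "0 \<le> Re z \<Longrightarrow> z \<noteq> 0 \<Longrightarrow> \<not> (AE s in M. s \<notin> {0<..<1}) \<Longrightarrow> 0 < Re (z * exp (- z) * F z)"
proof -
  interpret finite_measure M by fact
  have b: "AE s in M. \<forall>k. 0 \<le> 1 / (1 + s * real k) \<and> 1 / (1 + s * real k) \<le> 1"
    using M01 by eventually_elim (auto simp: divide_le_eq intro!: divide_nonneg_nonneg add_pos_nonneg)
  show "0 \<le> m k" unfolding m by (rule integral_nonneg_AE) (use b in auto)
  have "integrable M (\<lambda>s. 1 / (1 + s * real k))"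
    by (rule integrable_const_bound[of _ 1]) (use b in auto)
  then have "m k \<le> (\<integral>s. 1 \<partial>M)" unfolding m by (rule integral_mono_AE) (use b in auto)
  then show "m k \<le> measure M (space M)" by simp
  have b': "AE s in M. \<forall>k. \<bar>1 / (1 + s * real k)\<bar> \<le> 1" using b by eventually_elim auto
  define G where "G z s = (\<Sum>k. of_real (1 / (1 + s * real k)) / fact k * z ^ k)" for z :: complex and s :: real
  have sums: "(\<lambda>k. of_real (m k) / fact k * z ^ k) sums (\<integral>s. G z s \<partial>M)" and int: "integrable M (G z)" for z
    using exp_generating_integral[OF M _ b', of z] unfolding m G_def by auto
  then show "(\<lambda>k. of_real (m k) / fact k * z ^ k) sums F z"
    unfolding F by (simp add: sums_iff)
  have FG: "F z = (\<integral>s. G z s \<partial>M)" for z unfolding F using sums[of z] by (simp add: sums_iff)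
  have int': "integrable M (\<lambda>s. z * exp (- z) * G z s)" for z using int by (rule integrable_mult_right)
  have eq: "Re (z * exp (- z) * F z) = (\<integral>s. Re (z * exp (- z) * G z s) \<partial>M)" for z
    unfolding FG by (subst integral_Re[OF int']) simp
  have intR: "integrable M (\<lambda>s. Re (z * exp (- z) * G z s))" for z
    by (rule integrable_Re[OF int'])
  have nn: "AE s in M. 0 \<le> Re (z * exp (- z) * G z s)" if "0 \<le> Re z" for z
    using M01 by eventually_elim (unfold G_def, rule stieltjes_kernel_series(1), use that in auto)
  show F0: "0 \<le> Re (z * exp (- z) * F z)" if "0 \<le> Re z"
    unfolding eq by (rule integral_nonneg_AE[OF nn[OF that]])
  show "0 < Re (z * exp (- z) * F z)" if z: "0 \<le> Re z" "z \<noteq> 0" and "\<not> (AE s in M. s \<notin> {0<..<1})"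
  proof (rule ccontr)
    assume "\<not> 0 < Re (z * exp (- z) * F z)"
    then have "(\<integral>s. Re (z * exp (- z) * G z s) \<partial>M) = 0" using F0[OF z(1)] unfolding eq by linarith
    then have "AE s in M. Re (z * exp (- z) * G z s) = 0"
      using integral_nonneg_eq_0_iff_AE[OF intR nn[OF z(1)]] by simp
    then have "AE s in M. s \<notin> {0<..<1}"
    proof eventually_elim
      case (elim s)
      show ?case
      proof
        assume "s \<in> {0<..<1}"
        then have "0 < Re (z * exp (- z) * G z s)"
          unfolding G_def by (intro stieltjes_kernel_series(2)) (use z in auto)
        then show False using elim by linarith
      qed
    qed
    then show False using that by blast
  qed
qed

section \<open>Hurwitz stability of series with nonnegative coefficients\<close>

text \<open>The factor \<open>2 ^ k\<close> leaves room for the linear growth of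
  \<open>\<psi> k\<close> in the inverse class and still gives the majorant
  \<open>C * exp (2 * norm z)\<close>.\<close>

lemma exp_bounded_series:
  fixes c :: "nat \<Rightarrow> real" and z :: complex
  assumes c: "\<And>k. 0 \<le> c k" "\<And>k. c k \<le> C * 2 ^ k"
    and \<Phi>: "\<And>z. \<Phi> z = (\<Sum>k. of_real (c k) / fact k * z ^ k)"
  shows "summable (\<lambda>k. of_real (c k) / fact k * z ^ k)"
    and "norm (\<Phi> z) \<le> (\<Sum>k. c k / fact k * norm z ^ k)"
    and "summable (\<lambda>k. c k / fact k * norm z ^ k)"
    and "norm (\<Phi> z) \<le> C * exp (2 * norm z)"
    and "\<Phi> holomorphic_on UNIV"
proof -
  have "(\<lambda>k. (2 * norm z) ^ k /\<^sub>R fact k) sums exp (2 * norm z)" for z :: complex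
    by (rule exp_converges)
  from sums_mult[OF this, of C]
  have e: "(\<lambda>k. C * 2 ^ k / fact k * norm z ^ k) sums (C * exp (2 * norm z))" for z :: complex
    by (simp add: power_mult_distrib divide_inverse mult_ac)
  have le: "c k / fact k * norm z ^ k \<le> C * 2 ^ k / fact k * norm z ^ k" for k and z :: complex
    by (intro mult_right_mono divide_right_mono c) auto
  have n: "norm (of_real (c k) / fact k * z ^ k) = c k / fact k * norm z ^ k" for k and z :: complex
    using c(1)[of k] by (simp add: norm_mult norm_divide norm_power)
  have s: "summable (\<lambda>k. c k / fact k * norm z ^ k)" for z :: complex
    by (rule summable_comparison_test'[OF sums_summable[OF e[of z]], of 0])
       (use le[of _ z] c in \<open>simp add: abs_mult\<close>)
  then show "summable (\<lambda>k. c k / fact k * norm z ^ k)" .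
  have sn: "summable (\<lambda>k. norm (of_real (c k) / fact k * z ^ k))" for z :: complex
    unfolding n by (rule s)
  then show sz: "summable (\<lambda>k. of_real (c k) / fact k * z ^ k)" for z :: complex
    by (rule summable_norm_cancel)
  show 1: "norm (\<Phi> z) \<le> (\<Sum>k. c k / fact k * norm z ^ k)"
    using summable_norm[OF sn[of z]] unfolding \<Phi> n .
  also have "\<dots> \<le> C * exp (2 * norm z)"
    using suminf_le[OF le s sums_summable[OF e], of z] sums_unique[OF e[of z]] by simp
  finally show "norm (\<Phi> z) \<le> C * exp (2 * norm z)" .
  show "\<Phi> holomorphic_on UNIV"
  proof -
    have "\<Phi> holomorphic_on ball 0 r" for r :: real
    proof (rule power_series_holomorphic[of _ _ "\<lambda>k. of_real (c k) / fact k"])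
      fix w :: complex
      show "(\<lambda>n. of_real (c n) / fact n * (w - 0) ^ n) sums \<Phi> w"
        using sz[of w] by (simp add: summable_sums \<Phi>)
    qed
    then have "\<Phi> field_differentiable (at z)" for z
      using holomorphic_on_imp_differentiable_at[of \<Phi> "ball 0 (norm z + 1)" z] by simp
    then show ?thesis by (simp add: holomorphic_on_def)
  qed
qed

lemma ln_norm_mono: "norm w \<le> norm v \<Longrightarrow> ln_norm w \<le> ln_norm v"
  by (auto simp: ln_norm_def)

text \<open>Reduces stability to the location of the zeros. The coefficient bound yields exponential
  growth, and nonnegative coefficients give \<open>norm (\<Phi> (- r)) \<le> norm (\<Phi> r)\<close>
  for \<open>r > 0\<close>, hence the order of the indicator at \<open>pi\<close> and
  \<open>0\<close>.\<close>

lemma hurwitz_stableI: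
  fixes c :: "nat \<Rightarrow> real"
  assumes c: "\<And>k. 0 \<le> c k" "\<And>k. c k \<le> C * 2 ^ k"
    and \<Phi>: "\<And>z. \<Phi> z = (\<Sum>k. of_real (c k) / fact k * z ^ k)"
    and zeros: "\<And>z. 0 \<le> Re z \<Longrightarrow> \<Phi> z \<noteq> 0"
  shows "hurwitz_stable \<Phi>"
  unfolding hurwitz_stable_def
proof (intro conjI allI impI)
  note ser = exp_bounded_series[OF c \<Phi>]
  show "\<Phi> holomorphic_on UNIV" by (rule ser(5))
  have C: "0 \<le> C" using c[of 0] by simp
  \<comment> \<open>\<open>B \<ge> 1\<close> makes \<open>ln B\<close> nonnegative, so
    \<open>ln B \<le> norm z * ln B\<close> when \<open>norm z \<ge> 1\<close>.\<close>
  define B where "B = max 1 C"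
  have B: "1 \<le> B" "C \<le> B" by (auto simp: B_def)
  have "ereal (inverse (norm z)) * ln_norm (\<Phi> z) \<le> ereal (ln B + 2)" if z: "1 \<le> norm z" for z
  proof (cases "\<Phi> z = 0")
    case True
    \<comment> \<open>In the extended reals a zero factor would make this product \<open>0\<close>;
      \<open>1 \<le> norm z\<close> excludes that.\<close>
    have "ereal (inverse (norm z)) * - \<infinity> = - \<infinity>"
      using z by (cases "z = 0") auto
    then show ?thesis using True by (simp add: ln_norm_def)
  next
    case False
    have "norm (\<Phi> z) \<le> B * exp (2 * norm z)"
      using ser(4)[of z] B by (smt (verit) exp_gt_zero mult_right_mono)
    then have "ln (norm (\<Phi> z)) \<le> ln (B * exp (2 * norm z))"
      using False B by (subst ln_le_cancel_iff) auto
    also have "\<dots> = ln B + 2 * norm z" using B by (simp add: ln_mult)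
    also have "\<dots> \<le> norm z * ln B + 2 * norm z"
      using z B mult_right_mono[of 1 "norm z" "ln B"] by simp
    finally have "ln (norm (\<Phi> z)) \<le> norm z * (ln B + 2)" by (simp add: algebra_simps)
    moreover have "0 < norm z" using z by linarith
    ultimately have "inverse (norm z) * ln (norm (\<Phi> z)) \<le> ln B + 2"
      by (simp add: inverse_eq_divide pos_divide_le_eq mult.commute)
    then show ?thesis using False by (simp add: ln_norm_def)
  qed
  then have "eventually (\<lambda>z. ereal (inverse (norm z)) * ln_norm (\<Phi> z) \<le> ereal (ln B + 2)) at_infinity"
    unfolding eventually_at_infinity by blast
  then have "Limsup at_infinity (\<lambda>z. ereal (inverse (norm z)) * ln_norm (\<Phi> z)) \<le> ereal (ln B + 2)"
    by (rule Limsup_bounded)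
  also have "\<dots> < \<infinity>" by simp
  finally show "exponential_growth \<Phi>" unfolding exponential_growth_def .
  show "Re z < 0" if "\<Phi> z = 0" for z using zeros[of z] that by (meson not_le)
  show "indicator_function \<Phi> pi \<le> indicator_function \<Phi> 0"
    unfolding indicator_function_def
  proof (rule Limsup_mono)
    have "ereal (inverse r) * ln_norm (\<Phi> (of_real r * cis pi)) \<le> ereal (inverse r) * ln_norm (\<Phi> (of_real r * cis 0))"
      if "0 < r" for r :: real
    proof (intro ereal_mult_left_mono ln_norm_mono)
      have "norm (\<Phi> (of_real r * cis pi)) \<le> (\<Sum>k. c k / fact k * r ^ k)"
        using ser(2)[of "of_real r * cis pi"] that by (simp add: norm_mult)
      also have "(\<Sum>k. c k / fact k * r ^ k) \<le> norm (\<Phi> (of_real r * cis 0))"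
      proof -
        have "summable (\<lambda>k. c k / fact k * r ^ k)"
          using ser(3)[of "of_real r"] that by simp
        then have "complex_of_real (\<Sum>k. c k / fact k * r ^ k) = (\<Sum>k. of_real (c k / fact k * r ^ k))"
          by (rule suminf_of_real)
        then have "\<Phi> (of_real r) = of_real (\<Sum>k. c k / fact k * r ^ k)" by (simp add: \<Phi>)
        then show ?thesis by simp
      qed
      finally show "norm (\<Phi> (of_real r * cis pi)) \<le> norm (\<Phi> (of_real r * cis 0))" .
    next
      show "0 \<le> ereal (inverse r)" using that by simp
    qed
    then show "\<forall>\<^sub>F r in at_top. ereal (inverse r) * ln_norm (\<Phi> (of_real r * cis pi))
         \<le> ereal (inverse r) * ln_norm (\<Phi> (of_real r * cis 0))"
      by (intro eventually_mono[OF eventually_gt_at_top[of 0]])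
  qed
qed

section \<open>Stability\<close>

lemma stieltjes_integral_point_mass:
  fixes N :: "real measure" and x :: real
  assumes "AE s in N. s = s0" and [measurable_cong]: "sets N = sets borel"
  shows "(\<integral>s. 1 / (1 + s * x) \<partial>N) = measure N (space N) * (1 / (1 + s0 * x))"
proof -
  have "(\<integral>s. 1 / (1 + s * x) \<partial>N) = (\<integral>s. 1 / (1 + s0 * x) \<partial>N)"
    by (rule integral_cong_AE) (use assms(1) in \<open>auto elim: eventually_mono\<close>)
  then show ?thesis by simp
qed

text \<open>At \<open>x = k + 1\<close> the kernel is \<open>1 / (1 + s * k)\<close>, which is what
  anchoring at \<open>1\<close> provides. Hence \<open>E_fun \<psi> z = a * exp z + F z\<close>, and
  after multiplication by \<open>z * exp (- z)\<close> the real part is \<open>a * Re z\<close> plus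
  the strictly positive contribution of \<open>F\<close>.\<close>

lemma E_fun_stable:
  assumes "generic_S \<psi>"
  shows "hurwitz_stable (E_fun \<psi>)"
proof -
  have \<psi>: "\<psi> \<in> stieltjes_S" and nspecial: "\<not> special_S \<psi>"
    using assms by (auto simp: generic_S_def)
  obtain a N where a: "0 \<le> a" and N: "finite_measure N" "sets N = sets borel" "AE s in N. s \<in> {0<..1}"
    and rep: "\<And>x. 0 < x \<Longrightarrow> \<psi> (of_real x) = of_real (a + (\<integral>s. 1 / (1 + s * (x - 1)) \<partial>N))"
    using stieltjes_S_representation[OF \<psi>] by blast
  have hol: "\<psi> holomorphic_on - \<real>\<^sub>\<le>\<^sub>0" and nconst: "\<not> \<psi> constant_on - \<real>\<^sub>\<le>\<^sub>0"
    and pos: "\<And>x. 0 < x \<Longrightarrow> 0 < Re (\<psi> (of_real x))"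
    using \<psi> by (auto simp: stieltjes_S_def)
  have N01: "AE s in N. s \<in> {0..1}" using N(3) by eventually_elim auto
  define m where "m k = (\<integral>s. 1 / (1 + s * real k) \<partial>N)" for k
  define F where "F z = (\<Sum>k. of_real (m k) / fact k * z ^ k)" for z :: complex
  note mom = moment_series[OF N(1,2) N01 m_def F_def]
  have coeff: "\<psi> (of_nat (k + 1)) = of_real (a + m k)" for k
    using rep[of "real (k + 1)"] by (simp add: m_def)
  have sumsE: "(\<lambda>k. of_real (a + m k) / fact k * z ^ k) sums (of_real a * exp z + F z)" for z
  proof -
    have "(\<lambda>k. of_real a * (z ^ k /\<^sub>R fact k) + of_real (m k) / fact k * z ^ k) sums (of_real a * exp z + F z)"
      by (intro sums_add sums_mult exp_converges mom(3))
    then show ?thesis by (simp add: scaleR_conv_of_real field_simps)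
  qed
  have E: "E_fun \<psi> z = of_real a * exp z + F z" for z
    unfolding E_fun_def coeff using sums_unique[OF sumsE[of z]] by simp
  \<comment> \<open>If \<open>N\<close> does not charge the open interval, it is a mass
    \<open>b\<close> at \<open>s = 1\<close>, where the kernel is \<open>1 / x\<close>; then \<psi>
    is special.\<close>
  have ngen: "\<not> (AE s in N. s \<notin> {0<..<1})"
  proof
    assume "AE s in N. s \<notin> {0<..<1}"
    then have N1: "AE s in N. s = 1" using N(3) by eventually_elim auto
    define b where "b = measure N (space N)"
    have "\<psi> (of_real x) = of_real a + of_real b / of_real x" if "0 < x" for x
      using rep[OF that] stieltjes_integral_point_mass[OF N1 N(2), of "x - 1"] by (simp add: b_def)
    then have eq: "\<psi> z = of_real a + of_real b / z" if "z \<notin> \<real>\<^sub>\<le>\<^sub>0" for z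
      by (intro slit_plane_identity[OF hol _ _ that]) (auto intro!: holomorphic_intros)
    have "b \<noteq> 0" using nconst eq by (auto simp: constant_on_def)
    moreover have "0 \<le> b" by (simp add: b_def)
    ultimately have "special_S \<psi>" using a eq unfolding special_S_def by (intro exI[of _ a] exI[of _ b]) auto
    then show False using nspecial by simp
  qed
  show ?thesis
  proof (rule hurwitz_stableI[of "\<lambda>k. a + m k" "a + measure N (space N)"])
    fix k
    show "0 \<le> a + m k" using a mom(1) by simp
    have "a + m k \<le> (a + measure N (space N)) * 1" using mom(2)[of k] by simp
    also have "\<dots> \<le> (a + measure N (space N)) * 2 ^ k"
      using a by (intro mult_left_mono) auto
    finally show "a + m k \<le> (a + measure N (space N)) * 2 ^ k" .
  next
    fix z
    show "E_fun \<psi> z = (\<Sum>k. of_real (a + m k) / fact k * z ^ k)"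
      unfolding E using sums_unique[OF sumsE] .
  next
    fix z :: complex assume z: "0 \<le> Re z"
    show "E_fun \<psi> z \<noteq> 0"
    proof (cases "z = 0")
      case True
      \<comment> \<open>Multiplying by \<open>z\<close> loses the origin, where the value is the
        constant coefficient.\<close>
      have "E_fun \<psi> 0 = \<psi> 1"
        using sums_unique[OF powser_sums_zero[of "\<lambda>k. \<psi> (of_nat (k + 1)) / fact k"]] by (simp add: E_fun_def)
      then show ?thesis using True pos[of 1] by auto
    next
      case False
      have *: "Re (of_real a * z) = a * Re z" by simp
      have "z * exp (- z) * E_fun \<psi> z = of_real a * z + z * exp (- z) * F z"
        unfolding E by (simp add: distrib_left exp_minus)
      then have "Re (z * exp (- z) * E_fun \<psi> z) = a * Re z + Re (z * exp (- z) * F z)"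
        using * by (simp only: plus_complex.sel)
      moreover have "0 \<le> a * Re z" using a z by simp
      moreover have "0 < Re (z * exp (- z) * F z)" by (rule mom(5)[OF z False ngen])
      ultimately have "0 < Re (z * exp (- z) * E_fun \<psi> z)" by linarith
      then show ?thesis by (metis mult_zero_right zero_complex.sel(1) less_irrefl)
    qed
  qed
qed

section \<open>The inverse class by inversion\<close>

text \<open>Inversion preserves the slit plane and exchanges the half-planes, reversing the sign
  condition. Reflection brings \<open>1 / z\<close> back to the closed upper half-plane, where the
  hypothesis applies.\<close>

lemma stieltjes_S_inv_reciprocal:
  assumes "\<psi> \<in> stieltjes_S_inv"
  shows "(\<lambda>z. \<psi> (1 / z)) \<in> stieltjes_S"
proof -
  have slit: "1 / z \<notin> \<real>\<^sub>\<le>\<^sub>0" if "z \<notin> \<real>\<^sub>\<le>\<^sub>0" for z :: complex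
    using that nonpos_Reals_inverse_I[of "1 / z"] by (auto simp: inverse_eq_divide)
  have hol: "\<psi> holomorphic_on - \<real>\<^sub>\<le>\<^sub>0" and nconst: "\<not> \<psi> constant_on - \<real>\<^sub>\<le>\<^sub>0"
    and pos: "\<And>x::real. 0 < x \<Longrightarrow> \<psi> (of_real x) \<in> \<real> \<and> 0 < Re (\<psi> (of_real x))"
    and im: "\<And>z. z \<notin> \<real>\<^sub>\<le>\<^sub>0 \<Longrightarrow> 0 \<le> Im z \<Longrightarrow> 0 \<le> Im (\<psi> z)"
    using assms by (auto simp: stieltjes_S_inv_def)
  have refl: "Im (\<psi> (1 / z)) = - Im (\<psi> (cnj (1 / z)))" if "z \<notin> \<real>\<^sub>\<le>\<^sub>0" for z
    using slit_plane_reflection[OF hol _ slit[OF that]] pos by simp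
  show ?thesis
    unfolding stieltjes_S_def
  proof (intro CollectI conjI allI impI)
    have "(\<lambda>z. 1 / z) holomorphic_on - \<real>\<^sub>\<le>\<^sub>0" by (intro holomorphic_intros) auto
    from holomorphic_on_compose_gen[OF this hol]
    show "(\<lambda>z. \<psi> (1 / z)) holomorphic_on - \<real>\<^sub>\<le>\<^sub>0"
      using slit by (simp add: o_def image_subset_iff)
    show "\<not> (\<lambda>z. \<psi> (1 / z)) constant_on - \<real>\<^sub>\<le>\<^sub>0"
    proof
      assume "(\<lambda>z. \<psi> (1 / z)) constant_on - \<real>\<^sub>\<le>\<^sub>0"
      then obtain c where c: "\<And>z. z \<notin> \<real>\<^sub>\<le>\<^sub>0 \<Longrightarrow> \<psi> (1 / z) = c" by (auto simp: constant_on_def)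
      have "\<psi> z = c" if "z \<notin> \<real>\<^sub>\<le>\<^sub>0" for z using c[OF slit[OF that]] by simp
      then show False using nconst by (auto simp: constant_on_def)
    qed
    show "\<psi> (1 / of_real x) \<in> \<real>" "0 < Re (\<psi> (1 / of_real x))" if "0 < x" for x :: real
      using pos[of "1 / x"] that by auto
    show "Im (\<psi> (1 / z)) \<le> 0" if z: "z \<notin> \<real>\<^sub>\<le>\<^sub>0 \<and> 0 \<le> Im z" for z
    proof -
      have "cnj w \<notin> \<real>\<^sub>\<le>\<^sub>0" if "w \<notin> \<real>\<^sub>\<le>\<^sub>0" for w
        using that by (auto simp: complex_nonpos_Reals_iff)
      then have "cnj (1 / z) \<notin> \<real>\<^sub>\<le>\<^sub>0" using slit[of z] z by blast
      moreover have "0 \<le> Im (cnj (1 / z))" using z by (simp add: Im_divide)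
      ultimately have "0 \<le> Im (\<psi> (cnj (1 / z)))" by (rule im)
      then show ?thesis using refl[of z] z by simp
    qed
  qed
qed

text \<open>The representation of \<open>\<psi> (1 / z)\<close> is rewritten with
  \<open>1 - s\<close> for \<open>s\<close>, by
  \<open>1 / (1 + s * (1 / x - 1)) = x / (1 + (1 - s) * (x - 1))\<close>. As \<open>N\<close> has no
  atom at \<open>0\<close>, \<open>M\<close> has none at \<open>1\<close>, and the original kernel
  tends to \<open>0\<close> almost everywhere as \<open>x\<close> tends to \<open>0\<close>, which
  identifies \<open>a\<close> as the boundary value.\<close>

lemma stieltjes_S_inv_representation:
  assumes \<psi>: "\<psi> \<in> stieltjes_S_inv"
  shows "\<exists>a M. 0 \<le> a \<and> finite_measure M \<and> sets M = sets borel \<and> (AE s in M. s \<in> {0..<1}) \<and>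
    (\<forall>x>0. \<psi> (of_real x) = of_real (a + x * (\<integral>s. 1 / (1 + s * (x - 1)) \<partial>M))) \<and>
    value_at_0 \<psi> = of_real a"
proof -
  obtain a N where a: "0 \<le> a" and N: "finite_measure N" "AE s in N. s \<in> {0<..1}"
    and [simp, measurable_cong]: "sets N = sets borel"
    and rep0: "\<And>y. 0 < y \<Longrightarrow> \<psi> (1 / of_real y) = of_real (a + (\<integral>s. 1 / (1 + s * (y - 1)) \<partial>N))"
    using stieltjes_S_representation[OF stieltjes_S_inv_reciprocal[OF \<psi>]] by blast
  interpret finite_measure N by fact
  have rep: "\<psi> (of_real x) = of_real (a + (\<integral>s. 1 / (1 + s * (1 / x - 1)) \<partial>N))" if "0 < x" for x
    using rep0[of "1 / x"] that by simp
  define M where "M = distr N borel (\<lambda>s. 1 - s)"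
  have "finite_measure M" unfolding M_def by (rule finite_measure_distr) measurable
  moreover have "sets M = sets borel" by (simp add: M_def)
  moreover have "AE s in M. s \<in> {0..<1}"
    unfolding M_def using N(2) by (subst AE_distr_iff) (auto elim: eventually_mono)
  moreover have "\<psi> (of_real x) = of_real (a + x * (\<integral>s. 1 / (1 + s * (x - 1)) \<partial>M))" if x: "0 < x" for x
  proof -
    have "1 / (1 + s * (1 / x - 1)) = x * (1 / (1 + (1 - s) * (x - 1)))" for s
    proof -
      have "1 + s * (1 / x - 1) = (1 + (1 - s) * (x - 1)) / x" using x by (simp add: field_simps)
      then show ?thesis by simp
    qed
    then have "(\<integral>s. 1 / (1 + s * (1 / x - 1)) \<partial>N) = x * (\<integral>s. 1 / (1 + (1 - s) * (x - 1)) \<partial>N)"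
      by (simp only: integral_mult_right_zero)
    also have "(\<integral>s. 1 / (1 + (1 - s) * (x - 1)) \<partial>N) = (\<integral>s. 1 / (1 + s * (x - 1)) \<partial>M)"
      unfolding M_def by (subst integral_distr) auto
    finally show ?thesis by (simp only: rep[OF x])
  qed
  moreover have "value_at_0 \<psi> = of_real a"
    unfolding value_at_0_def
  proof (rule tendsto_Lim)
    show "((\<lambda>t. \<psi> (of_real t)) \<longlongrightarrow> of_real a) (at_right 0)"
    proof (rule tendsto_at_right_sequentially[of 0 1])
      fix X :: "nat \<Rightarrow> real" assume X: "\<And>n. 0 < X n" "\<And>n. X n < 1" "X \<longlonglongrightarrow> 0"
      have "(\<lambda>n. \<integral>s. 1 / (1 + s * (1 / X n - 1)) \<partial>N) \<longlonglongrightarrow> (\<integral>s. 0 \<partial>N)"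
      proof (rule integral_dominated_convergence)
        show "integrable N (\<lambda>_. 1 :: real)" by simp
        show "AE s in N. norm (1 / (1 + s * (1 / X n - 1))) \<le> 1" for n
          using N(2)
        proof eventually_elim
          case (elim s)
          have "0 \<le> s * (1 / X n - 1)" using elim X(1,2)[of n] by simp
          then show ?case by simp
        qed
        show "AE s in N. (\<lambda>n. 1 / (1 + s * (1 / X n - 1))) \<longlonglongrightarrow> 0"
          using N(2)
        proof eventually_elim
          case (elim s)
          have "(\<lambda>n. X n / (X n + s * (1 - X n))) \<longlonglongrightarrow> 0 / (0 + s * (1 - 0))"
            using elim by (intro tendsto_intros X(3)) auto
          moreover have "1 / (1 + s * (1 / X n - 1)) = X n / (X n + s * (1 - X n))" for n
          proof -
            have "1 + s * (1 / X n - 1) = (X n + s * (1 - X n)) / X n" using X(1)[of n] by (simp add: field_simps)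
            then show ?thesis by simp
          qed
          ultimately show ?case by simp
        qed
      qed auto
      then have "(\<lambda>n. complex_of_real (a + (\<integral>s. 1 / (1 + s * (1 / X n - 1)) \<partial>N))) \<longlonglongrightarrow> of_real (a + (\<integral>s. 0 \<partial>N))"
        by (intro tendsto_intros)
      then show "(\<lambda>n. \<psi> (of_real (X n))) \<longlonglongrightarrow> of_real a"
        by (simp only: rep[OF X(1)]) simp
    qed simp
  qed simp
  ultimately show ?thesis using a by blast
qed

text \<open>The factor \<open>x\<close> in the representation shifts the moments:
  \<open>E_minus \<psi> z = a * exp z + z * F z\<close>. If \<open>a > 0\<close>, multiplication by
  \<open>exp (- z)\<close> gives real part at least \<open>a\<close> in the closed right half-plane.
  If \<open>a = 0\<close>, one factor \<open>z\<close> splits off, and strict positivity excludes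
  zeros of \<open>F\<close>.\<close>

lemma E_minus_stable:
  assumes "generic_S_inv \<psi>"
  shows "value_at_0 \<psi> \<noteq> 0 \<Longrightarrow> hurwitz_stable (E_minus \<psi>)"
    and "value_at_0 \<psi> = 0 \<Longrightarrow> simple_root (E_minus \<psi>) 0"
    and "value_at_0 \<psi> = 0 \<Longrightarrow> hurwitz_stable (remove_sings (\<lambda>z. inverse z * E_minus \<psi> z))"
proof -
  have \<psi>: "\<psi> \<in> stieltjes_S_inv" and nspecial: "\<not> special_S_inv \<psi>"
    using assms by (auto simp: generic_S_inv_def)
  obtain a M where a: "0 \<le> a" and M: "finite_measure M" "sets M = sets borel" "AE s in M. s \<in> {0..<1}"
    and rep: "\<And>x. 0 < x \<Longrightarrow> \<psi> (of_real x) = of_real (a + x * (\<integral>s. 1 / (1 + s * (x - 1)) \<partial>M))"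
    and v0: "value_at_0 \<psi> = of_real a"
    using stieltjes_S_inv_representation[OF \<psi>] by blast
  have hol: "\<psi> holomorphic_on - \<real>\<^sub>\<le>\<^sub>0" and nconst: "\<not> \<psi> constant_on - \<real>\<^sub>\<le>\<^sub>0"
    and pos: "\<And>x. 0 < x \<Longrightarrow> 0 < Re (\<psi> (of_real x))"
    using \<psi> by (auto simp: stieltjes_S_inv_def)
  have M01: "AE s in M. s \<in> {0..1}" using M(3) by eventually_elim auto
  define m where "m k = (\<integral>s. 1 / (1 + s * real k) \<partial>M)" for k
  define F where "F z = (\<Sum>k. of_real (m k) / fact k * z ^ k)" for z :: complex
  note mom = moment_series[OF M(1,2) M01 m_def F_def]
  \<comment> \<open>At \<open>k = 0\<close> the truncated difference is harmless, because the factor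
    \<open>real k\<close> is zero.\<close>
  define c where "c k = a + real k * m (k - 1)" for k
  define B where "B = measure M (space M)"
  have B: "0 \<le> B" by (simp add: B_def)
  have c0: "0 \<le> c k" for k using a mom(1) by (simp add: c_def)
  have m_le: "m k \<le> B * 2 ^ k" for k
    using mom(2)[of k] mult_left_mono[of 1 "2 ^ k" B] B by (simp add: B_def)
  have c_le: "c k \<le> (a + B) * 2 ^ k" for k
  proof -
    have "real k \<le> 2 ^ k" using of_nat_less_two_power[of k, where 'a = real] by linarith
    then have "real k * m (k - 1) \<le> 2 ^ k * B"
      using mom(1,2)[of "k - 1"] by (intro mult_mono) (auto simp: B_def)
    moreover have "a * 1 \<le> a * 2 ^ k" using a by (intro mult_left_mono) auto
    ultimately show ?thesis by (simp add: c_def algebra_simps)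
  qed
  have coeff: "(if k = 0 then value_at_0 \<psi> else \<psi> (of_nat k)) = of_real (c k)" for k
    using rep[of "real k"] by (cases k) (auto simp: v0 c_def m_def)
  have sumsE: "(\<lambda>k. of_real (c k) / fact k * z ^ k) sums (of_real a * exp z + z * F z)" for z
  proof -
    let ?g = "\<lambda>k. of_real (real k * m (k - 1)) / fact k * z ^ k"
    have "(\<lambda>k. z * (of_real (m k) / fact k * z ^ k)) sums (z * F z)"
      by (intro sums_mult mom(3))
    moreover have "z * (of_real (m k) / fact k * z ^ k) = ?g (Suc k)" for k
      by (simp add: field_simps del: of_nat_Suc)
    ultimately have "(\<lambda>k. ?g (Suc k)) sums (z * F z)" by simp
    then have "?g sums (z * F z)" using sums_Suc[of ?g] by simp
    then have "(\<lambda>k. of_real a * (z ^ k /\<^sub>R fact k) + ?g k) sums (of_real a * exp z + z * F z)"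
      by (intro sums_add sums_mult exp_converges)
    then show ?thesis by (simp add: c_def scaleR_conv_of_real field_simps)
  qed
  have Ec: "E_minus \<psi> z = (\<Sum>k. of_real (c k) / fact k * z ^ k)" for z
    unfolding E_minus_def coeff ..
  have E: "E_minus \<psi> z = of_real a * exp z + z * F z" for z
    unfolding Ec using sums_unique[OF sumsE[of z]] by simp
  have F0: "F 0 = of_real (m 0)"
    using sums_unique[OF powser_sums_zero[of "\<lambda>k. of_real (m k) / fact k :: complex"]] by (simp add: F_def)
  show "hurwitz_stable (E_minus \<psi>)" if "value_at_0 \<psi> \<noteq> 0"
  proof (rule hurwitz_stableI[OF c0 c_le Ec])
    fix z :: complex assume z: "0 \<le> Re z"
    have "exp (- z) * E_minus \<psi> z = of_real a + z * exp (- z) * F z"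
      unfolding E by (simp add: distrib_left exp_minus)
    then have "Re (exp (- z) * E_minus \<psi> z) = a + Re (z * exp (- z) * F z)"
      by (simp only: plus_complex.sel Re_complex_of_real)
    moreover have "0 < a" using that a by (auto simp: v0)
    moreover have "0 \<le> Re (z * exp (- z) * F z)" by (rule mom(4)[OF z])
    ultimately have "0 < Re (exp (- z) * E_minus \<psi> z)" by linarith
    then show "E_minus \<psi> z \<noteq> 0" by (metis mult_zero_right zero_complex.sel(1) less_irrefl)
  qed
  assume "value_at_0 \<psi> = 0"
  then have a0: "a = 0" by (simp add: v0)
  have E0: "E_minus \<psi> z = z * F z" for z by (simp add: E a0)
  have m0: "0 < m 0" using pos[of 1] rep[of 1] by (simp add: a0 m_def)
  have Fhol: "F holomorphic_on UNIV" by (rule exp_bounded_series(5)[OF mom(1) m_le F_def])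
  \<comment> \<open>Without mass in the open interval, \<open>M\<close> sits at
    \<open>s = 0\<close>, where the kernel is \<open>1\<close>; then \<open>\<psi> z = B * z\<close>
    is special.\<close>
  have ngen: "\<not> (AE s in M. s \<notin> {0<..<1})"
  proof
    assume "AE s in M. s \<notin> {0<..<1}"
    then have M0: "AE s in M. s = 0" using M(3) by eventually_elim auto
    have "\<psi> (of_real x) = of_real 0 + of_real B * of_real x" if "0 < x" for x
      using rep[OF that] stieltjes_integral_point_mass[OF M0 M(2), of "x - 1"] by (simp add: B_def a0)
    then have eq: "\<psi> z = of_real 0 + of_real B * z" if "z \<notin> \<real>\<^sub>\<le>\<^sub>0" for z
      by (intro slit_plane_identity[OF hol _ _ that]) (auto intro!: holomorphic_intros)
    have "B \<noteq> 0" using nconst eq by (auto simp: constant_on_def)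
    then have "special_S_inv \<psi>" using B eq unfolding special_S_inv_def by (intro exI[of _ 0] exI[of _ B]) auto
    then show False using nspecial by simp
  qed
  show "simple_root (E_minus \<psi>) 0"
  proof -
    have "(F has_field_derivative deriv F 0) (at 0)"
      using Fhol by (simp add: holomorphic_derivI)
    then have "((\<lambda>z. z * F z) has_field_derivative F 0) (at 0)"
      by (auto intro!: derivative_eq_intros)
    then have "deriv (E_minus \<psi>) 0 = F 0"
      unfolding E0[abs_def] by (rule DERIV_imp_deriv)
    then show ?thesis using m0 by (simp add: simple_root_def E0 F0)
  qed
  \<comment> \<open>Since \<open>inverse 0 = 0\<close>, the raw quotient is \<open>0\<close> at the
    origin; \<open>remove_sings\<close> replaces this by the limit \<open>F 0\<close>, the positive
    number \<open>m 0\<close>.\<close>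
  have "remove_sings (\<lambda>z. inverse z * E_minus \<psi> z) = F"
  proof
    fix z
    have "isCont F z"
      using Fhol holomorphic_on_imp_continuous_on continuous_on_eq_continuous_at open_UNIV by blast
    then have "F \<midarrow>z\<rightarrow> F z" by (simp add: isCont_def)
    moreover have "\<forall>\<^sub>F w in at z. F w = inverse w * E_minus \<psi> w"
      using eventually_neq_at_within[of 0 z UNIV] by eventually_elim (simp add: E0)
    ultimately show "remove_sings (\<lambda>z. inverse z * E_minus \<psi> z) z = F z"
      by (intro remove_sings_eqI) (rule Lim_transform_eventually)
  qed
  moreover have "hurwitz_stable F"
  proof (rule hurwitz_stableI[OF mom(1) m_le F_def])
    fix z :: complex assume z: "0 \<le> Re z"
    show "F z \<noteq> 0"
    proof (cases "z = 0")
      case True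
      then show ?thesis using m0 F0 by simp
    next
      case False
      then have "0 < Re (z * exp (- z) * F z)" by (intro mom(5)[OF z _ ngen])
      then show ?thesis by (metis mult_zero_right zero_complex.sel(1) less_irrefl)
    qed
  qed
  ultimately show "hurwitz_stable (remove_sings (\<lambda>z. inverse z * E_minus \<psi> z))" by simp
qed

theorem theorem1:
  shows "(\<forall>\<psi>. generic_S \<psi> \<longrightarrow> hurwitz_stable (E_fun \<psi>)) \<and>
    (\<forall>\<psi>. generic_S_inv \<psi> \<longrightarrow>
       (value_at_0 \<psi> \<noteq> 0 \<longrightarrow> hurwitz_stable (E_minus \<psi>)) \<and>
       (value_at_0 \<psi> = 0 \<longrightarrow>
          simple_root (E_minus \<psi>) 0 \<and>
          hurwitz_stable (remove_sings (\<lambda>z. inverse z * E_minus \<psi> z))))"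
  using E_fun_stable E_minus_stable by blast

end
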